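(* [Bernstein estimate] Let $\alpha>0$, $\tau:=1/\alpha$, let $k\ge 2$ be an integer, and let $\mathcal I$ be a regular multilevel partition of $\mathbb R$. If $g\in\Sigma_n(\mathcal I)$, $n\in\mathbb N$, then $$\|g\|_{\dot B^{\alpha,k}_\tau}\le c\,n^{\alpha}\,\|g\|_{\mathrm{BMO}},$$ where $c>0$ is a constant depending only on $\alpha$, $k$, and the parameters of $\mathcal I$.
   Context: All functions are complex-valued. $\Pi_k$ is the set of univariate algebraic polynomials of degree at most $k-1$. $\|f\|_{\mathrm{BMO}}:=\sup_J \frac1{|J|}\int_J|f-\mathrm{Avg}_J f|\,dx$ over all compact intervals $J\subset\mathbb R$, with $\mathrm{Avg}_Jf=\frac1{|J|}\int_J f$. Regular multilevel partition: $\mathcal I=\bigcup_{m\in\mathbb Z}\mathcal I_m$, where (a) each $\mathcal I_m$ is a partition of $\mathbb R$ into compact intervals with disjoint interiors, $\mathcal I_m=\{[x_{m,j},x_{m,j+1}]:j\in\mathbb Z\}$ with $\cdots<x_{m,-1}<x_{m,0}<x_{m,1}<\cdots$; (b) $\mathcal I_{m+1}$ refines $\mathcal I_m$ and each $I\in\mathcal I_m$ has at least two and at most $M_0$ children in $\mathcal I_{m+1}$, $M_0\ge2$ a constant; (c) there is a constant $\lambda\ge1$ with $|I'|\le\lambda|I''|$ for all $I',I''\in\mathcal I_m$, $m\in\mathbb Z$. The parameters of $\mathcal I$ are $M_0,\lambda$. B-splines: $\mathcal Q_m:=\{[x_{m,j},x_{m,j+k}]:j\in\mathbb Z\}$, $\mathcal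 Q:=\bigcup_m\mathcal Q_m$ (elements are indexed together with their level). For $Q=[x_{m,j},x_{m,j+k}]\in\mathcal Q_m$, $\varphi_Q$ is the B-spline of degree $k-1$ with knots $x_{m,j},\dots,x_{m,j+k}$, normalized so that the B-splines of each level sum to $1$; its support is $Q$. $\Sigma_n(\mathcal I)$ is the set of all $g=\sum_{Q\in\Lambda_n}a_Q\varphi_Q$ with $a_Q\in\mathbb C$, $\Lambda_n\subset\mathcal Q$, $\#\Lambda_n\le n$ ($\Lambda_n$ may vary with $g$). Besov quasi-norm: for $I=[x_{m,j},x_{m,j+1}]\in\mathcal I_m$ set $\Omega_I:=[x_{m,j+1-k},x_{m,j+k}]$. For a compact interval $J$, $\omega_k(f,J)_q:=\sup_{h\in\mathbb R}\|\Delta_h^k(f,\cdot,J)\|_{L^q(J)}$, where $\Delta_h^k(f,x,J)=\sum_{i=0}^k(-1)^{k+i}\binom ki f(x+ih)$ if $[x,x+kh]\subset J$ and $0$ otherwise. Fix any $q\in[1,\infty)$. $\dot B^{\alpha,k}_\tau$ is the set of $f\in L^q_{loc}(\mathbb R)$ with $\|f\|_{\dot B^{\alpha,k}_\tau}:=\big(\sum_{I\in\mathcal I}(|I|^{-1/q}\omega_k(f,\Omega_I)_q)^\tau\big)^{1/\tau}<\infty$. (Different $q$ give the same space with equivalent quasi-norms; $\omega_k(f,\Omega_I)_q$ can equivalently be replaced by $\inf_{P\in\Pi_k}\|f-P\|_{L^q(\Omega_I)}$; when $\tau\ge1$ the quasi-norm is also equivalent to $\big(\int_0^\infty[t^{-\alpha}\omega_k(f,t)_\tau]^\tau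 dt/t\big)^{1/\tau}$, where $\omega_k(f,t)_\tau=\sup_{|h|\le t}\|\Delta_h^kf\|_{L^\tau(\mathbb R)}$. Constants may depend on which of these quasi-norms is fixed.) *)

theory Defs
  imports "HOL-Analysis.Analysis"
begin

text \<open>
  Norms and quasi-norms take values in \<^typ>\<open>ennreal\<close>, so that an inequality between them also
  asserts finiteness of the left-hand side whenever the right-hand side is finite.
  The library has no real powers on \<^typ>\<open>ennreal\<close>; this one is meant for positive exponents.
\<close>

definition ennreal_powr :: "ennreal \<Rightarrow> real \<Rightarrow> ennreal" where
  "ennreal_powr a p = (if a = \<infinity> then \<infinity> else ennreal (enn2real a powr p))"

definition interval_avg :: "real \<Rightarrow> real \<Rightarrow> (real \<Rightarrow> complex) \<Rightarrow> complex" where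
  "interval_avg a b f = (1 / (b - a)) *\<^sub>R set_lebesgue_integral lebesgue {a..b} f"

definition bmo_norm :: "(real \<Rightarrow> complex) \<Rightarrow> ennreal" where
  "bmo_norm f =
     (SUP (a, b) \<in> {(a, b). a < b}.
        ennreal (1 / (b - a)) *
        (\<integral>\<^sup>+ x \<in> {a..b}. ennreal (norm (f x - interval_avg a b f)) \<partial>lebesgue))"

text \<open>
  A multilevel partition is given by its nodes: \<open>x m j\<close> is the \<open>j\<close>-th node of level \<open>m\<close>.
\<close>

definition level_intervals :: "(int \<Rightarrow> int \<Rightarrow> real) \<Rightarrow> int \<Rightarrow> real set set" where
  "level_intervals x m = range (\<lambda>j. {x m j .. x m (j + 1)})"

definition regular_multilevel_partition ::
    "nat \<Rightarrow> real \<Rightarrow> (int \<Rightarrow> int \<Rightarrow> real) \<Rightarrow> bool" where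
  "regular_multilevel_partition M0 lam x \<longleftrightarrow>
     (\<forall>m. strict_mono (x m) \<and> \<Union> (level_intervals x m) = UNIV) \<and>
     (\<forall>m. \<forall>I' \<in> level_intervals x (m + 1). \<exists>I \<in> level_intervals x m. I' \<subseteq> I) \<and>
     (\<forall>m. \<forall>I \<in> level_intervals x m.
        finite {I' \<in> level_intervals x (m + 1). I' \<subseteq> I} \<and>
        2 \<le> card {I' \<in> level_intervals x (m + 1). I' \<subseteq> I} \<and>
        card {I' \<in> level_intervals x (m + 1). I' \<subseteq> I} \<le> M0) \<and>
     (\<forall>m. \<forall>I \<in> level_intervals x m. \<forall>J \<in> level_intervals x m.
        measure lebesgue I \<le> lam * measure lebesgue J)"

text \<open>
  The B-spline of degree \<open>d\<close> with knots \<open>t j, \<dots>, t (j + d + 1)\<close>, by the Cox--de Boor recursion.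
  The recursion yields the normalization in which the B-splines sum to 1
  (lemma \<open>sum_bspline\<close> below). For \<open>d \<ge> 1\<close> and strictly increasing knots they are continuous,
  so the half-open interval in degree 0 is immaterial.
\<close>

fun bspline :: "(int \<Rightarrow> real) \<Rightarrow> nat \<Rightarrow> int \<Rightarrow> real \<Rightarrow> real" where
  "bspline t 0 j u = (if t j \<le> u \<and> u < t (j + 1) then 1 else 0)"
| "bspline t (Suc d) j u =
     (u - t j) / (t (j + int d + 1) - t j) * bspline t d j u +
     (t (j + int d + 2) - u) / (t (j + int d + 2) - t (j + 1)) * bspline t d (j + 1) u"

lemma bspline_eq_0:
  assumes "strict_mono t" "u \<notin> {t j ..< t (j + int d + 1)}"
  shows "bspline t d j u = 0"
  using assms(2)
proof (induction d arbitrary: j)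
  case (Suc d)
  have "t j < t (j + 1)" "t (j + int d + 1) < t (j + int d + 2)"
    using assms(1) by (simp_all add: strict_mono_less)
  with Suc.prems have "u \<notin> {t j ..< t (j + int d + 1)}" "u \<notin> {t (j + 1) ..< t (j + 1 + int d + 1)}"
    by (auto simp: algebra_simps)
  with Suc.IH show ?case by simp
qed auto

lemma sum_bspline:
  assumes "strict_mono t" "t i \<le> u" "u < t (i + 1)"
  shows "(\<Sum>j = i - int d .. i. bspline t d j u) = 1"
proof (induction d)
  case (Suc d)
  define w where "w j = (u - t j) / (t (j + int d + 1) - t j)" for j
  have w: "(t (j + int d + 2) - u) / (t (j + int d + 2) - t (j + 1)) = 1 - w (j + 1)" for j
  proof -
    have "t (j + 1) < t (j + int d + 2)"
      using assms(1) by (simp add: strict_mono_less)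
    then show ?thesis by (simp add: w_def field_simps)
  qed
  have "t (i - int d - 1 + int d + 1) \<le> u" "u < t (i + 1)"
    using assms(2,3) by (simp_all add: algebra_simps)
  then have z: "bspline t d (i - int d - 1) u = 0" "bspline t d (i + 1) u = 0"
    by (auto intro!: bspline_eq_0 assms(1))
  have "(\<Sum>j = i - int (Suc d) .. i. bspline t (Suc d) j u) =
        (\<Sum>j = i - int d - 1 .. i. w j * bspline t d j u) +
        (\<Sum>j = i - int d - 1 .. i. (1 - w (j + 1)) * bspline t d (j + 1) u)"
    by (simp add: sum.distrib w flip: w_def) (simp add: algebra_simps)
  also have "(\<Sum>j = i - int d - 1 .. i. w j * bspline t d j u) =
        (\<Sum>j = i - int d .. i. w j * bspline t d j u)"
  proof (intro sum.mono_neutral_right ballI)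
    fix j assume "j \<in> {i - int d - 1 .. i} - {i - int d .. i}"
    then have "j = i - int d - 1" by auto
    with z show "w j * bspline t d j u = 0" by simp
  qed auto
  also have "(\<Sum>j = i - int d - 1 .. i. (1 - w (j + 1)) * bspline t d (j + 1) u) =
        (\<Sum>j = i - int d .. i + 1. (1 - w j) * bspline t d j u)"
    by (rule sum.reindex_bij_witness[of _ "\<lambda>j. j - 1" "\<lambda>j. j + 1"]) auto
  also have "\<dots> = (\<Sum>j = i - int d .. i. (1 - w j) * bspline t d j u)"
  proof (intro sum.mono_neutral_right ballI)
    fix j assume "j \<in> {i - int d .. i + 1} - {i - int d .. i}"
    then have "j = i + 1" by auto
    with z show "(1 - w j) * bspline t d j u = 0" by simp
  qed auto
  finally show ?case
    using Suc.IH by (simp add: algebra_simps flip: sum.distrib)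
qed (use assms in simp)

text \<open>
  \<open>\<Sigma>\<^sub>n\<close> for B-splines of order \<open>k\<close> (degree \<open>k - 1\<close>); the support
  \<open>Q = [x m j, x m (j + k)]\<close> of \<open>\<phi>\<^sub>Q\<close>, together with its level, is encoded as the pair \<open>(m, j)\<close>.
\<close>

definition nterm_splines :: "nat \<Rightarrow> (int \<Rightarrow> int \<Rightarrow> real) \<Rightarrow> nat \<Rightarrow> (real \<Rightarrow> complex) set" where
  "nterm_splines k x n =
     {g. \<exists>(\<Lambda> :: (int \<times> int) set) (a :: int \<times> int \<Rightarrow> complex).
           finite \<Lambda> \<and> card \<Lambda> \<le> n \<and>
           g = (\<lambda>u. \<Sum>(m, j) \<in> \<Lambda>. a (m, j) * of_real (bspline (x m) (k - 1) j u))}"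

text \<open>
  Since \<open>h\<close> ranges over all reals, \<open>[x, x + k h]\<close> denotes the segment between its end points
  also for \<open>h < 0\<close>.
\<close>

definition fin_diff :: "nat \<Rightarrow> real \<Rightarrow> (real \<Rightarrow> complex) \<Rightarrow> real set \<Rightarrow> real \<Rightarrow> complex" where
  "fin_diff k h f J x =
     (if closed_segment x (x + real k * h) \<subseteq> J
      then \<Sum>i = 0..k. (- 1) ^ (k + i) * of_nat (k choose i) * f (x + real i * h)
      else 0)"

definition Lq_norm_on :: "real \<Rightarrow> real set \<Rightarrow> (real \<Rightarrow> complex) \<Rightarrow> ennreal" where
  "Lq_norm_on q J f =
     ennreal_powr (\<integral>\<^sup>+ x \<in> J. ennreal (norm (f x) powr q) \<partial>lebesgue) (1 / q)"

definition modulus_smoothness :: "nat \<Rightarrow> real \<Rightarrow> (real \<Rightarrow> complex) \<Rightarrow> real set \<Rightarrow> ennreal" where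
  "modulus_smoothness k q f J = (SUP h. Lq_norm_on q J (fin_diff k h f J))"

text \<open>
  The pair \<open>(m, j)\<close> stands for \<open>I = [x m j, x m (j + 1)]\<close>. For a regular multilevel partition every
  interval has at least two children, so different pairs give different intervals and the sum
  below is the sum over all intervals of the partition. As \<open>\<tau> = 1 / \<alpha>\<close>, the quasi-norm depends on
  the smoothness \<open>\<alpha>\<close> only through \<open>\<tau>\<close>.
\<close>

definition besov_quasinorm ::
    "nat \<Rightarrow> real \<Rightarrow> real \<Rightarrow> (int \<Rightarrow> int \<Rightarrow> real) \<Rightarrow> (real \<Rightarrow> complex) \<Rightarrow> ennreal" where
  "besov_quasinorm k q \<tau> x f =
     ennreal_powr
       (\<Sum>\<^sub>\<infinity>(m, j) \<in> (UNIV :: (int \<times> int) set).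
          ennreal_powr
            (ennreal ((x m (j + 1) - x m j) powr (- 1 / q)) *
             modulus_smoothness k q f {x m (j + 1 - int k) .. x m (j + int k)})
            \<tau>)
       (1 / \<tau>)"

end

theory Submission
  imports Defs
begin

text \<open>
  Let \<open>B\<close> bound the BMO norm of \<open>g\<close>. For an interval \<open>I\<close> of level \<open>m\<close> split \<open>g\<close> into the coarse
  part \<open>S\<close>, made of the B-splines of levels below \<open>m\<close>, and the fine part, and give \<open>I\<close> the weight
  \<open>\<Sum>\<^sub>Q \<rho> ^ (level Q - m)\<close>, the sum being over the fine B-splines whose supports meet \<open>\<Omega>\<^sub>I\<close>. The
  weight dominates the proportion of \<open>\<Omega>\<^sub>I\<close> covered by the fine supports, and the sum over \<open>I\<close> of
  any positive power (at most 1) of the weights is \<open>O(n)\<close>.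

  By the John--Nirenberg inequality each term of the Besov quasi-norm is at most a constant times
  \<open>B\<close>; this suffices for the \<open>O(n)\<close> bad intervals, those whose weight exceeds a threshold.
  If \<open>I\<close> is good, then on each interval of level \<open>m\<close> in \<open>\<Omega>\<^sub>I\<close> the coarse part is a polynomial that
  agrees with \<open>g\<close> on a large set. Hence \<open>S\<close> differs from the mean of \<open>g\<close> by \<open>O(B)\<close>, has Lipschitz
  constant \<open>O(B / \<bar>I\<bar>)\<close>, and the John--Nirenberg inequality with a larger exponent bounds the fine
  part by a power of the weight. If the last bad ancestor of \<open>I\<close> is \<open>s\<close> levels above, no B-spline
  of the levels in between reaches \<open>\<Omega>\<^sub>I\<close>. So either \<open>S\<close> is a polynomial on \<open>\<Omega>\<^sub>I\<close>, or \<open>\<Omega>\<^sub>I\<close>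
  contains a node of the ancestor's level and, \<open>S\<close> being continuous because \<open>k \<ge> 2\<close>, the
  oscillation of \<open>S\<close> on \<open>\<Omega>\<^sub>I\<close> is \<open>O(\<rho> ^ s B)\<close>. The latter happens for boundedly many \<open>I\<close> for each
  bad ancestor and each \<open>s\<close>.
\<close>

section \<open>The John--Nirenberg inequality\<close>

text \<open>The gauge-integral form of \<open>interval_avg\<close>; for continuous functions the two
  agree by \<open>interval_avg_eq_avg\<close>.\<close>

definition avg :: "real \<Rightarrow> real \<Rightarrow> (real \<Rightarrow> complex) \<Rightarrow> complex" where
  "avg a b f = (1 / (b - a)) *\<^sub>R integral {a..b} f"

text \<open>The sum is at most twice the larger term, which works for exponents on either side of
  1.\<close>

lemma powr_add_le:
  fixes a b r :: real
  assumes "a \<ge> 0" "b \<ge> 0" "r > 0"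
  shows "(a + b) powr r \<le> 2 powr r * (a powr r + b powr r)"
proof -
  have "(a + b) powr r \<le> (2 * max a b) powr r"
    using assms by (intro powr_mono2) auto
  also have "\<dots> = 2 powr r * max a b powr r"
    using assms by (simp add: powr_mult)
  also have "max a b powr r \<le> a powr r + b powr r"
    by (auto simp: max_def)
  finally show ?thesis by (simp add: mult_left_mono)
qed

lemma continuous_on_norm_diff_powr:
  fixes f g :: "real \<Rightarrow> complex"
  assumes "continuous_on S f" "continuous_on S g" "r > 0"
  shows "continuous_on S (\<lambda>x. norm (f x - g x) powr r)"
  using assms by (intro continuous_on_powr' continuous_intros) auto

lemma norm_avg_diff_le:
  fixes f :: "real \<Rightarrow> complex"
  assumes "continuous_on {a..b} f" "a < b"
  shows "norm (avg a b f - c) \<le> integral {a..b} (\<lambda>x. norm (f x - c)) / (b - a)"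
proof -
  have i: "f integrable_on {a..b}"
    using assms by (intro integrable_continuous_real)
  have "integral {a..b} (\<lambda>x. f x - c) = integral {a..b} f - (b - a) *\<^sub>R c"
    using assms i by (subst integral_diff) auto
  then have "avg a b f - c = (1 / (b - a)) *\<^sub>R integral {a..b} (\<lambda>x. f x - c)"
    using assms by (simp add: avg_def scaleR_diff_right)
  moreover have "norm (integral {a..b} (\<lambda>x. f x - c)) \<le> integral {a..b} (\<lambda>x. norm (f x - c))"
    using assms by (intro integral_norm_bound_integral integrable_continuous_real continuous_intros) auto
  ultimately show ?thesis
    using assms by (simp add: divide_right_mono)
qed

text \<open>
  Halve \<open>[a, b]\<close> repeatedly, stopping at a piece whose average is further than \<open>l\<close> from \<open>c\<close>:
  on the stopped pieces the assumed bound \<open>X\<close> is paid for by the integral of \<open>\<bar>f - c\<bar>\<close>.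
\<close>

lemma john_nirenberg_step:
  fixes f :: "real \<Rightarrow> complex"
  assumes cont: "continuous_on UNIV f" and r: "r > 0" and l: "l > 0" and X: "X \<ge> 0" and d: "d > 0"
    and bmo: "\<And>a b. a < b \<Longrightarrow> integral {a..b} (\<lambda>x. norm (f x - avg a b f)) \<le> b - a"
    and XI: "\<And>a b. a < b \<Longrightarrow> integral {a..b} (\<lambda>x. norm (f x - avg a b f) powr r) \<le> X * (b - a)"
    and uc: "\<And>u v. u \<in> {a0..b0} \<Longrightarrow> v \<in> {a0..b0} \<Longrightarrow> \<bar>u - v\<bar> < d \<Longrightarrow> norm (f u - f v) \<le> 1"
    and "a0 \<le> a" "a < b" "b \<le> b0" "b - a < d * 2 ^ N" "norm (avg a b f - c) \<le> l"
  shows "integral {a..b} (\<lambda>x. norm (f x - c) powr r) \<le>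
    (l + 1) powr r * (b - a) +
    2 powr r * (X + (l + 2) powr r) / l * integral {a..b} (\<lambda>x. norm (f x - c))"
  using assms(9-)
proof (induction N arbitrary: a b)
  have cf: "continuous_on S f" for S
    using cont continuous_on_subset by blast
  note int = integrable_continuous_real
  note ci = cf continuous_on_norm_diff_powr continuous_intros r
  have nn: "0 \<le> integral {a..b} (\<lambda>x. norm (f x - c))" for a b
    by (intro integral_nonneg int ci) auto
  define K where "K = 2 powr r * (X + (l + 2) powr r) / l"
  have K: "K \<ge> 0" using X l by (simp add: K_def)
  {
    case 0
    \<comment> \<open>Here \<open>b - a < d\<close>, so \<open>f\<close> differs from its average by
      at most 1 at every point.\<close>
    have "norm (f x - c) powr r \<le> (l + 1) powr r" if x: "x \<in> {a..b}" for x
    proof -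
      have "norm (avg a b f - f x) \<le> integral {a..b} (\<lambda>u. norm (f u - f x)) / (b - a)"
        using 0 by (intro norm_avg_diff_le ci)
      also have "integral {a..b} (\<lambda>u. norm (f u - f x)) \<le> integral {a..b} (\<lambda>u. 1)"
        using 0 x by (intro integral_le int ci uc) auto
      finally have "norm (avg a b f - f x) \<le> 1"
        using 0 by (simp add: divide_right_mono)
      then have "norm (f x - c) \<le> l + 1"
        using 0(5) norm_triangle_ineq[of "f x - avg a b f" "avg a b f - c"]
        by (simp add: norm_minus_commute)
      then show ?thesis using r by (intro powr_mono2) auto
    qed
    then have "integral {a..b} (\<lambda>x. norm (f x - c) powr r) \<le> integral {a..b} (\<lambda>x. (l + 1) powr r)"
      by (intro integral_le int ci) auto
    also have "\<dots> = (l + 1) powr r * (b - a)"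
      using 0 by simp
    finally show ?case using K nn[of a b] unfolding K_def by (smt (verit) mult_nonneg_nonneg)
  next
    case (Suc N)
    define m where "m = (a + b) / 2"
    have m: "a < m" "m < b" "m - a = (b - a) / 2" "b - m = (b - a) / 2"
      using Suc.prems by (auto simp: m_def field_simps)
    have half: "integral {u..v} (\<lambda>x. norm (f x - c) powr r) \<le>
        (l + 1) powr r * (v - u) + K * integral {u..v} (\<lambda>x. norm (f x - c))"
      if uv: "a \<le> u" "v \<le> b" "v - u = (b - a) / 2" for u v
    proof (cases "norm (avg u v f - c) \<le> l")
      case True
      have "a0 \<le> u" "u < v" "v \<le> b0" "v - u < d * 2 ^ N"
        using uv Suc.prems by (auto simp: field_simps)
      from Suc.IH[OF this True] show ?thesis unfolding K_def .
    next
      case False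
      have u: "u < v" using uv Suc.prems by auto
      \<comment> \<open>On a stopped half the average moves by at most 2 from that of the whole
        interval, because halving the length at most doubles the mean oscillation.\<close>
      have "norm (avg u v f - avg a b f) \<le>
          integral {u..v} (\<lambda>x. norm (f x - avg a b f)) / (v - u)"
        using u by (intro norm_avg_diff_le ci)
      also have "integral {u..v} (\<lambda>x. norm (f x - avg a b f)) \<le>
          integral {a..b} (\<lambda>x. norm (f x - avg a b f))"
        using uv by (intro integral_subset_le int ci) auto
      also have "\<dots> \<le> b - a" using Suc.prems by (intro bmo)
      finally have "norm (avg u v f - avg a b f) \<le> (b - a) / (v - u)"
        using u by (simp add: divide_right_mono)
      also have "(b - a) / (v - u) = 2"
        using uv u by (simp add: field_simps)
      finally have "norm (avg u v f - avg a b f) \<le> 2" .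
      then have av: "norm (avg u v f - c) \<le> l + 2"
        using Suc.prems(5) norm_triangle_ineq[of "avg u v f - avg a b f" "avg a b f - c"] by simp
      have pt: "norm (f x - c) powr r \<le>
          2 powr r * (norm (f x - avg u v f) powr r + (l + 2) powr r)" for x
      proof -
        have "norm (f x - c) \<le> norm (f x - avg u v f) + (l + 2)"
          using av norm_triangle_ineq[of "f x - avg u v f" "avg u v f - c"] by simp
        then have "norm (f x - c) powr r \<le> (norm (f x - avg u v f) + (l + 2)) powr r"
          using r by (intro powr_mono2) auto
        also have "\<dots> \<le> 2 powr r * (norm (f x - avg u v f) powr r + (l + 2) powr r)"
          using r l by (intro powr_add_le) auto
        finally show ?thesis .
      qed
      have "integral {u..v} (\<lambda>x. norm (f x - c) powr r) \<le>
          integral {u..v} (\<lambda>x. 2 powr r * (norm (f x - avg u v f) powr r + (l + 2) powr r))"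
        by (intro integral_le int ci pt)
      also have "\<dots> = 2 powr r * (integral {u..v} (\<lambda>x. norm (f x - avg u v f) powr r) + (l + 2) powr r * (v - u))"
      proof -
        have "(\<lambda>x. norm (f x - avg u v f) powr r) integrable_on {u..v}"
          by (intro int ci)
        from Henstock_Kurzweil_Integration.integral_add[OF this integrable_const_ivl]
        show ?thesis using u by simp
      qed
      also have "\<dots> \<le> 2 powr r * (X * (v - u) + (l + 2) powr r * (v - u))"
        using XI[OF u] by (intro mult_left_mono add_right_mono) auto
      also have "\<dots> = K * (l * (v - u))"
      proof -
        have "K * l = 2 powr r * (X + (l + 2) powr r)" using l by (simp add: K_def)
        then show ?thesis by (simp only: mult.assoc[symmetric]) (simp only: distrib_right mult.assoc)
      qed
      \<comment> \<open>The stopping condition bounds \<open>l * (v - u)\<close> by the integral of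
        the distance to \<open>c\<close>; hence the divisor \<open>l\<close> in
        \<open>K\<close>.\<close>
      also have "\<dots> \<le> K * integral {u..v} (\<lambda>x. norm (f x - c))"
      proof (rule mult_left_mono[OF _ K])
        have "norm (avg u v f - c) \<le> integral {u..v} (\<lambda>x. norm (f x - c)) / (v - u)"
          using u by (intro norm_avg_diff_le ci)
        with False have "l \<le> integral {u..v} (\<lambda>x. norm (f x - c)) / (v - u)" by linarith
        then show "l * (v - u) \<le> integral {u..v} (\<lambda>x. norm (f x - c))"
          using u by (simp add: field_simps)
      qed
      finally show ?thesis using u by (smt (verit) mult_nonneg_nonneg powr_ge_zero)
    qed
    have 1: "integral {a..m} (\<lambda>x. norm (f x - c) powr r) + integral {m..b} (\<lambda>x. norm (f x - c) powr r) =
        integral {a..b} (\<lambda>x. norm (f x - c) powr r)"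
      using m by (intro Henstock_Kurzweil_Integration.integral_combine int ci) auto
    have 2: "integral {a..m} (\<lambda>x. norm (f x - c)) + integral {m..b} (\<lambda>x. norm (f x - c)) =
        integral {a..b} (\<lambda>x. norm (f x - c))"
      using m by (intro Henstock_Kurzweil_Integration.integral_combine int ci) auto
    have "integral {a..b} (\<lambda>x. norm (f x - c) powr r) \<le>
       ((l + 1) powr r * (m - a) + K * integral {a..m} (\<lambda>x. norm (f x - c))) +
       ((l + 1) powr r * (b - m) + K * integral {m..b} (\<lambda>x. norm (f x - c)))"
      unfolding 1[symmetric] using m by (intro add_mono half) auto
    also have "\<dots> = (l + 1) powr r * (b - a) + K * integral {a..b} (\<lambda>x. norm (f x - c))"
      unfolding 2[symmetric] by (simp add: algebra_simps)
    finally show ?case unfolding K_def .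
  }
qed

text \<open>Self-improvement: let \<open>X\<close> be the supremum of the normalized
  \<open>r\<close>-th mean oscillations, finite because \<open>f\<close> is bounded. The choice
  \<open>l = 2 powr (r + 1)\<close> turns the previous lemma into \<open>X \<le> C + X / 2\<close>,
  and the resulting bound \<open>2 * C\<close> is independent of \<open>N\<close>.\<close>

lemma john_nirenberg_unit:
  fixes f :: "real \<Rightarrow> complex"
  assumes cont: "continuous_on UNIV f" and bdd: "\<And>x. norm (f x) \<le> N" and r: "r > 0"
    and bmo: "\<And>a b. a < b \<Longrightarrow> integral {a..b} (\<lambda>x. norm (f x - avg a b f)) \<le> b - a"
    and ab: "a < b"
  shows "integral {a..b} (\<lambda>x. norm (f x - avg a b f) powr r) \<le>
    2 * ((2 powr (r + 1) + 1) powr r + (2 powr (r + 1) + 2) powr r) * (b - a)"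
proof -
  define l :: real where "l = 2 powr (r + 1)"
  have l: "l > 0" by (simp add: l_def)
  have cf: "continuous_on S f" for S
    using cont continuous_on_subset by blast
  note int = integrable_continuous_real
  note ci = cf continuous_on_norm_diff_powr continuous_intros r
  define F where "F = (\<lambda>(a, b). integral {a..b} (\<lambda>x. norm (f x - avg a b f) powr r) / (b - a))"
  define T where "T = {(a::real, b). a < b}"
  define X where "X = (SUP p\<in>T. F p)"
  have N: "N \<ge> 0" using bdd[of 0] norm_ge_zero[of "f 0"] by linarith
  have F0: "F p \<ge> 0" if pT: "p \<in> T" for p
  proof -
    obtain a b where p: "p = (a, b)" "a < b" using pT by (auto simp: T_def)
    have "0 \<le> integral {a..b} (\<lambda>x. norm (f x - avg a b f) powr r)"
      by (intro integral_nonneg int ci) auto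
    then show ?thesis using p by (simp add: F_def)
  qed
  have FN: "F p \<le> (2 * N) powr r" if pT: "p \<in> T" for p
  proof -
    obtain a b where p: "p = (a, b)" "a < b" using pT by (auto simp: T_def)
    have "norm (avg a b f - 0) \<le> integral {a..b} (\<lambda>x. norm (f x - 0)) / (b - a)"
      using p by (intro norm_avg_diff_le ci)
    also have "integral {a..b} (\<lambda>x. norm (f x - 0)) \<le> integral {a..b} (\<lambda>x. N)"
      using bdd by (intro integral_le int ci) auto
    finally have "norm (avg a b f) \<le> N" using p by (simp add: divide_right_mono)
    then have "norm (f x - avg a b f) \<le> 2 * N" for x
      using bdd[of x] norm_triangle_ineq4[of "f x" "avg a b f"] by linarith
    then have "integral {a..b} (\<lambda>x. norm (f x - avg a b f) powr r) \<le> integral {a..b} (\<lambda>x. (2 * N) powr r)"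
      using r by (intro integral_le int ci powr_mono2) auto
    then show ?thesis using p by (simp add: F_def field_simps)
  qed
  have bddF: "bdd_above (F ` T)" using FN by (auto intro!: bdd_aboveI2)
  have X: "F p \<le> X" if pT: "p \<in> T" for p
    unfolding X_def by (rule cSUP_upper[OF pT bddF])
  have T1: "(0, 1) \<in> T" by (simp add: T_def)
  have X0: "X \<ge> 0" using X[OF T1] F0[OF T1] by linarith
  define C where "C = (l + 1) powr r + (l + 2) powr r"
  have "F p \<le> C + X / 2" if pT: "p \<in> T" for p
  proof -
    obtain a b where p: "p = (a, b)" "a < b" using pT by (auto simp: T_def)
    have "uniformly_continuous_on {a..b} f"
      by (intro compact_uniformly_continuous ci compact_Icc)
    then obtain d where d: "d > 0"
      "\<And>u v. u \<in> {a..b} \<Longrightarrow> v \<in> {a..b} \<Longrightarrow> dist v u < d \<Longrightarrow> dist (f v) (f u) < 1"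
      unfolding uniformly_continuous_on_def by (metis zero_less_one)
    obtain n where n: "(b - a) / d < 2 ^ n"
      using real_arch_pow[of 2 "(b - a) / d"] by auto
    have "integral {a..b} (\<lambda>x. norm (f x - avg a b f) powr r) \<le>
        (l + 1) powr r * (b - a) + 2 powr r * (X + (l + 2) powr r) / l *
        integral {a..b} (\<lambda>x. norm (f x - avg a b f))"
    proof (rule john_nirenberg_step[OF cont r l X0 d(1) bmo])
      show "integral {a..b} (\<lambda>x. norm (f x - avg a b f) powr r) \<le> X * (b - a)"
        if "a < b" for a b
        using X[of "(a, b)"] that by (simp add: T_def F_def field_simps)
      show "norm (f u - f v) \<le> 1" if "u \<in> {a..b}" "v \<in> {a..b}" "\<bar>u - v\<bar> < d" for u v
        using d(2)[of v u] that by (auto simp: dist_norm)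
    qed (use p n d l in \<open>auto simp: field_simps\<close>)
    also have "\<dots> \<le> (l + 1) powr r * (b - a) + 2 powr r * (X + (l + 2) powr r) / l * (b - a)"
      using p X0 l by (intro add_left_mono mult_left_mono bmo) auto
    also have "2 powr r * (X + (l + 2) powr r) / l = (X + (l + 2) powr r) / 2"
      by (simp add: l_def powr_add)
    also have "(l + 1) powr r * (b - a) + (X + (l + 2) powr r) / 2 * (b - a) \<le> (C + X / 2) * (b - a)"
    proof -
      have "(l + 1) powr r + (X + (l + 2) powr r) / 2 \<le> C + X / 2"
        by (simp add: C_def field_simps)
      then have "((l + 1) powr r + (X + (l + 2) powr r) / 2) * (b - a) \<le> (C + X / 2) * (b - a)"
        using p by (intro mult_right_mono) auto
      then show ?thesis by (simp only: distrib_right)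
    qed
    finally show ?thesis using p by (simp add: F_def field_simps)
  qed
  then have "X \<le> C + X / 2" unfolding X_def using T1 by (intro cSUP_least) auto
  then have "F (a, b) \<le> 2 * C" using X[of "(a, b)"] ab by (simp add: T_def)
  then show ?thesis using ab by (simp add: F_def C_def l_def field_simps)
qed

definition jn_const :: "real \<Rightarrow> real" where
  "jn_const r = 2 * ((2 powr (r + 1) + 1) powr r + (2 powr (r + 1) + 2) powr r)"

text \<open>Apply the normalized case to \<open>f\<close> divided by \<open>B\<close>; the integrand
  scales by \<open>B powr r\<close>.\<close>

lemma john_nirenberg:
  fixes f :: "real \<Rightarrow> complex"
  assumes cont: "continuous_on UNIV f" and bdd: "\<And>x. norm (f x) \<le> N" and r: "r > 0" and B: "B > 0"
    and bmo: "\<And>a b. a < b \<Longrightarrow> integral {a..b} (\<lambda>x. norm (f x - avg a b f)) \<le> B * (b - a)"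
    and ab: "a < b"
  shows "integral {a..b} (\<lambda>x. norm (f x - avg a b f) powr r) \<le> jn_const r * B powr r * (b - a)"
proof -
  define h where "h x = (1 / B) *\<^sub>R f x" for x
  have eq: "norm (h x - avg a b h) = norm (f x - avg a b f) / B" for x a b
  proof -
    have "avg a b h = (1 / B) *\<^sub>R avg a b f"
      unfolding avg_def h_def integral_cmul by simp
    then show ?thesis using B by (simp add: h_def flip: scaleR_diff_right)
  qed
  have "integral {a..b} (\<lambda>x. norm (h x - avg a b h) powr r) \<le> jn_const r * (b - a)"
    unfolding jn_const_def
  proof (rule john_nirenberg_unit[OF _ _ r _ ab])
    show "continuous_on UNIV h" unfolding h_def using cont B by (intro continuous_intros) auto
    show "norm (h x) \<le> N / B" for x using bdd[of x] B by (simp add: h_def divide_right_mono)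
    show "integral {a..b} (\<lambda>x. norm (h x - avg a b h)) \<le> b - a" if "a < b" for a b
      using bmo[OF that] B by (simp add: eq field_simps)
  qed
  then show ?thesis using B by (simp add: eq powr_divide field_simps)
qed

section \<open>Polynomials and finite differences\<close>

lemma poly_root_quotient:
  fixes p :: "complex poly"
  obtains r where "p = [:poly p c:] + [:- c, 1:] * r" "degree r \<le> degree p - 1"
proof
  show "p = [:poly p c:] + [:- c, 1:] * synthetic_div p c"
    using synthetic_div_correct'[of c p] by (simp add: add.commute)
  show "degree (synthetic_div p c) \<le> degree p - 1"
    by (simp add: degree_synthetic_div)
qed

text \<open>
  By Newton interpolation: divide by \<open>u - c\<close> for one of the points \<open>c\<close> and induct on the degree.
\<close>

lemma poly_bound_of_separated_points:
  fixes \<eta> :: real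
  assumes "\<eta> > 0"
  shows "\<exists>A>0. \<forall>(p :: complex poly) a b Y M.
    degree p \<le> d \<longrightarrow> a < b \<longrightarrow> Y \<subseteq> {a..b} \<longrightarrow> card Y = Suc d \<longrightarrow>
    (\<forall>y\<in>Y. \<forall>y'\<in>Y. y \<noteq> y' \<longrightarrow> \<eta> * (b - a) \<le> \<bar>y - y'\<bar>) \<longrightarrow>
    (\<forall>y\<in>Y. norm (poly p (of_real y)) \<le> M) \<longrightarrow>
    (\<forall>u\<in>{a..b}. norm (poly p (of_real u)) \<le> A * M) \<and>
    (\<forall>u\<in>{a..b}. \<forall>v\<in>{a..b}.
       norm (poly p (of_real u) - poly p (of_real v)) \<le> A * M * \<bar>u - v\<bar> / (b - a))"
proof (induction d)
  case 0
  show ?case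
  proof (intro exI[of _ 1] conjI allI impI ballI)
    fix p :: "complex poly" and a b M :: real and Y :: "real set"
    assume p: "degree p \<le> 0" "a < b" "card Y = Suc 0" "\<forall>y\<in>Y. norm (poly p (of_real y)) \<le> M"
    then obtain c where c: "p = [:c:]" by (metis degree_eq_zeroE le_zero_eq)
    moreover obtain y where "y \<in> Y" using p(3) by fastforce
    ultimately have M: "norm c \<le> M" using p by auto
    show "norm (poly p (of_real u)) \<le> 1 * M" for u using c M by simp
    show "norm (poly p (of_real u) - poly p (of_real v)) \<le> 1 * M * \<bar>u - v\<bar> / (b - a)" for u v
      using c M p(2) order_trans[OF norm_ge_zero M] by simp
  qed simp
next
  case (Suc d)
  obtain A where A: "A > 0" and IH:
    "\<forall>(p :: complex poly) a b Y M.
    degree p \<le> d \<longrightarrow> a < b \<longrightarrow> Y \<subseteq> {a..b} \<longrightarrow> card Y = Suc d \<longrightarrow>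
    (\<forall>y\<in>Y. \<forall>y'\<in>Y. y \<noteq> y' \<longrightarrow> \<eta> * (b - a) \<le> \<bar>y - y'\<bar>) \<longrightarrow>
    (\<forall>y\<in>Y. norm (poly p (of_real y)) \<le> M) \<longrightarrow>
    (\<forall>u\<in>{a..b}. norm (poly p (of_real u)) \<le> A * M) \<and>
    (\<forall>u\<in>{a..b}. \<forall>v\<in>{a..b}.
       norm (poly p (of_real u) - poly p (of_real v)) \<le> A * M * \<bar>u - v\<bar> / (b - a))"
    using Suc.IH by (elim exE conjE) (rule that)
  \<comment> \<open>The 1 pays for the value at \<open>c\<close>, the factor
    \<open>2 / \<eta>\<close> for passing to the quotient by \<open>u - c\<close>, and the other 2
    for the two terms of the product rule.\<close>
  define A' where "A' = 1 + 2 * A * (2 / \<eta>)"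
  show ?case
  proof (intro exI[of _ A'], intro conjI[of "A' > 0"] allI impI)
    show "A' > 0" using A assms by (simp add: A'_def add_pos_pos)
    fix p :: "complex poly" and a b M :: real and Y :: "real set"
    assume p: "degree p \<le> Suc d" and ab: "a < b" and Y: "Y \<subseteq> {a..b}" "card Y = Suc (Suc d)"
      and sep: "\<forall>y\<in>Y. \<forall>y'\<in>Y. y \<noteq> y' \<longrightarrow> \<eta> * (b - a) \<le> \<bar>y - y'\<bar>"
      and M: "\<forall>y\<in>Y. norm (poly p (of_real y)) \<le> M"
    obtain c where c: "c \<in> Y" using Y(2) by fastforce
    have M0: "M \<ge> 0" using M c norm_ge_zero order_trans by blast
    obtain r where r: "p = [:poly p (of_real c):] + [:- of_real c, 1:] * r" "degree r \<le> degree p - 1"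
      by (rule poly_root_quotient)
    have pr: "poly p (of_real u) = poly p (of_real c) + of_real (u - c) * poly r (of_real u)" for u
      by (subst r(1)) (simp add: algebra_simps)
    define K where "K = A * (2 * M / (\<eta> * (b - a)))"
    have K0: "K \<ge> 0" using A M0 assms ab by (simp add: K_def)
    have K: "K * (b - a) = 2 * A / \<eta> * M" using ab by (simp add: K_def)
    have "(\<forall>u\<in>{a..b}. norm (poly r (of_real u)) \<le> K) \<and>
      (\<forall>u\<in>{a..b}. \<forall>v\<in>{a..b}. norm (poly r (of_real u) - poly r (of_real v)) \<le> K * \<bar>u - v\<bar> / (b - a))"
      unfolding K_def
    proof (rule IH[THEN spec[of _ r], THEN spec[of _ a], THEN spec[of _ b], THEN spec[of _ "Y - {c}"],
          THEN spec, THEN mp, THEN mp, THEN mp, THEN mp, THEN mp, THEN mp])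
      show "card (Y - {c}) = Suc d" using c Y by (simp add: card_Diff_singleton)
      \<comment> \<open>A value of \<open>r\<close> is a difference of two values of
        \<open>p\<close> divided by a distance of at least \<open>\<eta> * (b - a)\<close>.\<close>
      show "\<forall>y\<in>Y - {c}. norm (poly r (of_real y)) \<le> 2 * M / (\<eta> * (b - a))"
      proof
        fix y assume y: "y \<in> Y - {c}"
        have "\<eta> * (b - a) * norm (poly r (of_real y)) \<le> \<bar>y - c\<bar> * norm (poly r (of_real y))"
          using sep c y by (intro mult_right_mono) auto
        also have "\<dots> = norm (poly p (of_real y) - poly p (of_real c))"
          by (simp add: pr[of y] norm_mult del: of_real_diff)
        also have "\<dots> \<le> M + M" using M y c by (intro norm_triangle_le_diff add_mono) auto
        finally show "norm (poly r (of_real y)) \<le> 2 * M / (\<eta> * (b - a))"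
          using assms ab by (simp add: field_simps)
      qed
    qed (use p ab Y sep r in auto)
    then have rb: "\<And>u. u \<in> {a..b} \<Longrightarrow> norm (poly r (of_real u)) \<le> K"
      and rl0: "\<forall>u\<in>{a..b}. \<forall>v\<in>{a..b}. norm (poly r (of_real u) - poly r (of_real v)) \<le> K * \<bar>u - v\<bar> / (b - a)"
      by auto
    have rl: "norm (poly r (of_real u) - poly r (of_real v)) \<le> K * \<bar>u - v\<bar> / (b - a)"
      if "u \<in> {a..b}" "v \<in> {a..b}" for u v
      using that rl0 by auto
    have cab: "c \<in> {a..b}" using c Y by auto
    have uc: "\<bar>u - c\<bar> \<le> b - a" if "u \<in> {a..b}" for u
      using that cab by auto
    show "(\<forall>u\<in>{a..b}. norm (poly p (of_real u)) \<le> A' * M) \<and>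
      (\<forall>u\<in>{a..b}. \<forall>v\<in>{a..b}.
         norm (poly p (of_real u) - poly p (of_real v)) \<le> A' * M * \<bar>u - v\<bar> / (b - a))"
    proof (intro conjI ballI)
      fix u assume u: "u \<in> {a..b}"
      have "norm (poly p (of_real u)) \<le> norm (poly p (of_real c)) + \<bar>u - c\<bar> * norm (poly r (of_real u))"
        unfolding pr[of u] by (rule order_trans[OF norm_triangle_ineq]) (simp add: norm_mult del: of_real_diff)
      also have "\<dots> \<le> M + (b - a) * K"
        using M c u rb uc K0 ab by (intro add_mono mult_mono) auto
      also have "\<dots> = (1 + 2 * A / \<eta>) * M" using K by (simp add: algebra_simps)
      also have "\<dots> \<le> A' * M"
        using A assms M0 by (intro mult_right_mono) (auto simp: A'_def field_simps)
      finally show "norm (poly p (of_real u)) \<le> A' * M" .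
      fix v assume v: "v \<in> {a..b}"
      have "poly p (of_real u) - poly p (of_real v) =
          of_real (u - v) * poly r (of_real u) + of_real (v - c) * (poly r (of_real u) - poly r (of_real v))"
        by (simp add: pr[of u] pr[of v] algebra_simps)
      then have "norm (poly p (of_real u) - poly p (of_real v)) \<le>
          \<bar>u - v\<bar> * norm (poly r (of_real u)) + \<bar>v - c\<bar> * norm (poly r (of_real u) - poly r (of_real v))"
        by (metis norm_mult norm_of_real norm_triangle_ineq)
      also have "\<dots> \<le> \<bar>u - v\<bar> * K + (b - a) * (K * \<bar>u - v\<bar> / (b - a))"
        using u v rb[OF u] rl[OF u v] uc[OF v] ab by (intro add_mono mult_mono) auto
      also have "\<dots> = 2 * (K * (b - a)) * \<bar>u - v\<bar> / (b - a)" using ab by simp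
      also have "\<dots> \<le> A' * M * \<bar>u - v\<bar> / (b - a)"
        using ab M0 A assms unfolding K
        by (intro divide_right_mono mult_right_mono) (auto simp: A'_def field_simps)
      finally show "norm (poly p (of_real u) - poly p (of_real v)) \<le> A' * M * \<bar>u - v\<bar> / (b - a)" .
    qed
  qed
qed

text \<open>Pascal's rule and an index shift: a difference of order \<open>Suc k\<close> is one of
  order \<open>k\<close> applied to first differences. In this form
  \<open>difference_poly_eq_0\<close> follows by induction on the order.\<close>

lemma binomial_difference_Suc:
  fixes F :: "nat \<Rightarrow> complex"
  shows "(\<Sum>i=0..Suc k. (- 1) ^ (Suc k + i) * of_nat (Suc k choose i) * F i) =
    (\<Sum>i=0..k. (- 1) ^ (k + i) * of_nat (k choose i) * (F (Suc i) - F i))"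
proof -
  let ?t = "\<lambda>k i. (- 1 :: complex) ^ (k + i) * of_nat (k choose i)"
  have 1: "(\<Sum>i=0..Suc k. G i) = G 0 + (\<Sum>i=0..k. G (Suc i))" for G :: "nat \<Rightarrow> complex"
    by (subst sum.atLeast0_atMost_Suc_shift) (simp only: o_def)
  have 2: "?t (Suc k) (Suc i) = ?t k i - ?t k (Suc i)" for i
    by (simp add: algebra_simps)
  have "(\<Sum>i=0..k. ?t k i * F i) = (\<Sum>i=0..Suc k. ?t k i * F i)"
    by simp
  then have 3: "(\<Sum>i=0..k. ?t k i * F i) = ?t k 0 * F 0 + (\<Sum>i=0..k. ?t k (Suc i) * F (Suc i))"
    by (simp only: 1)
  show ?thesis
    unfolding 1 2 left_diff_distrib right_diff_distrib sum_subtractf 3 by simp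
qed

text \<open>If \<open>r\<close> is the difference of \<open>p\<close>, then that of
  \<open>z * p z\<close> is \<open>z * r z + h * (p z + r z)\<close>, which gives the induction.
  Constants have a clause of their own because \<open>degree p - 1\<close> is truncated at
  0.\<close>

lemma poly_shift_diff:
  fixes p :: "complex poly"
  shows "\<exists>r. degree r \<le> degree p - 1 \<and> (degree p = 0 \<longrightarrow> r = 0) \<and>
    (\<forall>z. poly p (z + h) - poly p z = poly r z)"
proof (induction p)
  case 0
  then show ?case by (intro exI[of _ 0]) auto
next
  case (pCons a p)
  then obtain r where r: "degree r \<le> degree p - 1" "degree p = 0 \<longrightarrow> r = 0"
    "\<And>z. poly p (z + h) - poly p z = poly r z" by auto
  show ?case
  proof (cases "p = 0")
    case True
    then show ?thesis by (intro exI[of _ 0]) auto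
  next
    case False
    have "degree (pCons 0 r) \<le> degree p"
      using r by (cases "degree p = 0") (auto simp: degree_pCons_eq_if)
    moreover have "degree (smult h (p + r)) \<le> degree p"
      using r by (intro order_trans[OF degree_smult_le] degree_add_le) auto
    ultimately have "degree (pCons 0 r + smult h (p + r)) \<le> degree p"
      by (rule degree_add_le)
    moreover have "poly (pCons a p) (z + h) - poly (pCons a p) z = poly (pCons 0 r + smult h (p + r)) z" for z
      by (simp add: r(3)[symmetric] algebra_simps)
    ultimately show ?thesis using False by (intro exI[of _ "pCons 0 r + smult h (p + r)"]) auto
  qed
qed

lemma difference_poly_eq_0:
  fixes p :: "complex poly"
  assumes "degree p < k"
  shows "(\<Sum>i=0..k. (- 1) ^ (k + i) * of_nat (k choose i) * poly p (z + of_nat i * h)) = 0"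
  using assms
proof (induction k arbitrary: p)
  case (Suc k)
  obtain r where r: "degree r \<le> degree p - 1" "degree p = 0 \<longrightarrow> r = 0"
    "\<And>z. poly p (z + h) - poly p z = poly r z" using poly_shift_diff by blast
  have eq: "poly p (z + of_nat (Suc i) * h) - poly p (z + of_nat i * h) = poly r (z + of_nat i * h)" for i
    using r(3)[of "z + of_nat i * h"] by (simp add: algebra_simps)
  show ?case
  proof (cases "degree p = 0")
    case True
    with r show ?thesis unfolding binomial_difference_Suc eq by simp
  next
    case False
    with Suc.prems r(1) have "degree r < k" by auto
    then show ?thesis unfolding binomial_difference_Suc eq by (rule Suc.IH)
  qed
qed simp

section \<open>B-splines\<close>

text \<open>Each step of the recursion multiplies by affine factors and so raises the degree by at
  most one. The cells are half-open to match degree 0; \<open>coarse_poly\<close> closes them by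
  continuity.\<close>

lemma bspline_piecewise_poly:
  assumes "strict_mono t"
  shows "\<exists>p :: complex poly. degree p \<le> d \<and>
    (\<forall>u\<in>{t l..<t (l + 1)}. of_real (bspline t d j u) = poly p (of_real u))"
proof (induction d arbitrary: j)
  case 0
  have "t j \<le> u \<and> u < t (j + 1) \<longleftrightarrow> j = l" if "u \<in> {t l..<t (l + 1)}" for u
  proof
    assume "t j \<le> u \<and> u < t (j + 1)"
    then have "t j < t (l + 1)" "t l < t (j + 1)" using that by auto
    then show "j = l" using assms by (simp add: strict_mono_less)
  qed (use that in auto)
  then show ?case by (intro exI[of _ "[:if j = l then 1 else 0:]"]) auto
next
  case (Suc d)
  obtain p q :: "complex poly" where p: "degree p \<le> d"
    "\<And>u. u \<in> {t l..<t (l + 1)} \<Longrightarrow> of_real (bspline t d j u) = poly p (of_real u)"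
    and q: "degree q \<le> d"
    "\<And>u. u \<in> {t l..<t (l + 1)} \<Longrightarrow> of_real (bspline t d (j + 1) u) = poly q (of_real u)"
    using Suc.IH[of j] Suc.IH[of "j + 1"] by auto
  define c1 c2 where "c1 = complex_of_real (1 / (t (j + int d + 1) - t j))"
    and "c2 = complex_of_real (1 / (t (j + int d + 2) - t (j + 1)))"
  define P where "P = smult c1 ([:- of_real (t j), 1:] * p) +
    smult c2 ([:of_real (t (j + int d + 2)), -1:] * q)"
  have "degree ([:- of_real (t j), 1:] * p) \<le> Suc d" "degree ([:of_real (t (j + int d + 2)), -1:] * q) \<le> Suc d"
    using p(1) q(1) degree_mult_le[of "[:- of_real (t j), 1:]" p]
      degree_mult_le[of "[:of_real (t (j + int d + 2)), -1:]" q] by auto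
  then have "degree P \<le> Suc d"
    unfolding P_def by (intro degree_add_le order_trans[OF degree_smult_le])
  moreover have "of_real (bspline t (Suc d) j u) = poly P (of_real u)" if "u \<in> {t l..<t (l + 1)}" for u
  proof -
    have "poly P (of_real u) = c1 * ((of_real u - of_real (t j)) * poly p (of_real u)) +
        c2 * ((of_real (t (j + int d + 2)) - of_real u) * poly q (of_real u))"
      by (simp add: P_def algebra_simps)
    then show ?thesis
      by (simp add: c1_def c2_def p(2)[OF that, symmetric] q(2)[OF that, symmetric])
  qed
  ultimately show ?case by blast
qed

text \<open>Writing the hat function with \<open>min\<close> and \<open>max\<close> of affine
  functions makes its continuity evident; this is the base case of
  \<open>continuous_on_bspline\<close>.\<close>

lemma bspline_1:
  assumes "strict_mono t"
  shows "bspline t (Suc 0) j u =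
    max 0 (min ((u - t j) / (t (j + 1) - t j)) ((t (j + 2) - u) / (t (j + 2) - t (j + 1))))"
proof -
  have t: "t j < t (j + 1)" "t (j + 1) < t (j + 2)"
    using assms by (simp_all add: strict_mono_less)
  have aux: "max 0 (min a b) = b" if "a \<ge> 1" "b \<le> 1" "b \<ge> 0" for a b :: real
    using that by (auto simp: min_def max_def)
  consider "u < t j" | "t j \<le> u" "u < t (j + 1)" | "t (j + 1) \<le> u" "u < t (j + 2)" | "t (j + 2) \<le> u"
    by linarith
  then show ?thesis
  proof cases
    case 1
    then have "(u - t j) / (t (j + 1) - t j) \<le> 0" using t by (simp add: divide_le_0_iff)
    then show ?thesis using 1 t by simp
  next
    case 2
    then have "(u - t j) / (t (j + 1) - t j) \<le> 1" "(u - t j) / (t (j + 1) - t j) \<ge> 0"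
      "(t (j + 2) - u) / (t (j + 2) - t (j + 1)) \<ge> 1"
      using t by (simp_all add: field_simps)
    moreover from this have "(u - t j) / (t (j + 1) - t j) \<le> (t (j + 2) - u) / (t (j + 2) - t (j + 1))"
      by linarith
    ultimately show ?thesis using 2 t by (simp add: min_def)
  next
    case 3
    then have "(u - t j) / (t (j + 1) - t j) \<ge> 1"
      "(t (j + 2) - u) / (t (j + 2) - t (j + 1)) \<le> 1" "(t (j + 2) - u) / (t (j + 2) - t (j + 1)) \<ge> 0"
      using t by (simp_all add: field_simps)
    then have "max 0 (min ((u - t j) / (t (j + 1) - t j)) ((t (j + 2) - u) / (t (j + 2) - t (j + 1)))) =
        (t (j + 2) - u) / (t (j + 2) - t (j + 1))"
      by (rule aux)
    then show ?thesis using 3 t by (simp add: add.commute)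
  next
    case 4
    then have "(t (j + 2) - u) / (t (j + 2) - t (j + 1)) \<le> 0" using t by (simp add: divide_le_0_iff)
    then show ?thesis using 4 t by (simp add: add.commute)
  qed
qed

lemma continuous_on_bspline:
  assumes "strict_mono t"
  shows "continuous_on S (bspline t (Suc d) j)"
proof (induction d arbitrary: j)
  case 0
  have t: "t j < t (j + 1)" "t (j + 1) < t (j + 2)"
    using assms by (simp_all add: strict_mono_less)
  have "bspline t (Suc 0) j =
    (\<lambda>u. max 0 (min ((u - t j) / (t (j + 1) - t j)) ((t (j + 2) - u) / (t (j + 2) - t (j + 1)))))"
    using bspline_1[OF assms] by blast
  moreover have "continuous_on S \<dots>" using t by (intro continuous_intros) auto
  ultimately show ?case by simp
next
  case (Suc d)
  have "bspline t (Suc (Suc d)) j = (\<lambda>u.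
     (u - t j) / (t (j + int (Suc d) + 1) - t j) * bspline t (Suc d) j u +
     (t (j + int (Suc d) + 2) - u) / (t (j + int (Suc d) + 2) - t (j + 1)) * bspline t (Suc d) (j + 1) u)"
    by (rule ext) (rule bspline.simps)
  moreover have "continuous_on S \<dots>"
  proof (intro continuous_intros Suc.IH)
    show "\<forall>u\<in>S. t (j + int (Suc d) + 1) - t j \<noteq> 0"
      using strict_mono_less[OF assms, of j "j + int (Suc d) + 1"] by auto
    show "\<forall>u\<in>S. t (j + int (Suc d) + 2) - t (j + 1) \<noteq> 0"
      using strict_mono_less[OF assms, of "j + 1" "j + int (Suc d) + 2"] by auto
  qed
  ultimately show ?case by simp
qed

lemma bounded_bspline:
  assumes "strict_mono t"
  shows "\<exists>N. \<forall>u. \<bar>bspline t (Suc d) j u\<bar> \<le> N"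
proof -
  have "compact (bspline t (Suc d) j ` {t j..t (j + int (Suc d) + 1)})"
    by (intro compact_continuous_image continuous_on_bspline assms compact_Icc)
  then obtain N where N: "\<And>u. u \<in> {t j..t (j + int (Suc d) + 1)} \<Longrightarrow> \<bar>bspline t (Suc d) j u\<bar> \<le> N"
    by (metis bounded_iff compact_imp_bounded imageI real_norm_def)
  have "\<bar>bspline t (Suc d) j u\<bar> \<le> max 0 N" for u
  proof (cases "u \<in> {t j..t (j + int (Suc d) + 1)}")
    case True
    then show ?thesis using N by (simp add: le_max_iff_disj)
  next
    case False
    then have "bspline t (Suc d) j u = 0" by (intro bspline_eq_0 assms) auto
    then show ?thesis by simp
  qed
  then show ?thesis by blast
qed

text \<open>The sums of \<open>nterm_splines\<close>, with the index set as an argument so that they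
  can be split by level.\<close>

definition spline :: "(int \<Rightarrow> int \<Rightarrow> real) \<Rightarrow> nat \<Rightarrow> (int \<times> int) set \<Rightarrow> (int \<times> int \<Rightarrow> complex) \<Rightarrow> real \<Rightarrow> complex" where
  "spline x d \<Lambda> a u = (\<Sum>(m, j) \<in> \<Lambda>. a (m, j) * of_real (bspline (x m) d j u))"

lemma continuous_on_spline:
  assumes "\<And>m. strict_mono (x m)" "d \<ge> 1"
  shows "continuous_on S (spline x d \<Lambda> a)"
proof -
  obtain e where d: "d = Suc e" using assms(2) by (cases d) auto
  show ?thesis unfolding spline_def d case_prod_unfold
    by (intro continuous_intros continuous_on_bspline assms)
qed

text \<open>A qualitative bound that makes the John--Nirenberg inequality applicable; its value
  enters no constant.\<close>

lemma bounded_spline: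
  assumes "\<And>m. strict_mono (x m)" "d \<ge> 1"
  shows "\<exists>N. \<forall>u. norm (spline x d \<Lambda> a u) \<le> N"
proof -
  obtain e where d: "d = Suc e" using assms(2) by (cases d) auto
  have "\<forall>q. \<exists>N. \<forall>u. \<bar>bspline (x (fst q)) d (snd q) u\<bar> \<le> N"
    unfolding d using bounded_bspline assms(1) by blast
  then obtain N where N: "\<And>q u. \<bar>bspline (x (fst q)) d (snd q) u\<bar> \<le> N q" by metis
  have "norm (spline x d \<Lambda> a u) \<le> (\<Sum>q\<in>\<Lambda>. norm (a q) * N q)" for u
    unfolding spline_def case_prod_unfold using N
    by (intro sum_norm_le) (auto simp: norm_mult intro!: mult_left_mono)
  then show ?thesis by blast
qed

lemma spline_union:
  assumes "finite A" "finite B" "A \<inter> B = {}"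
  shows "spline x d (A \<union> B) a u = spline x d A a u + spline x d B a u"
  unfolding spline_def using assms by (rule sum.union_disjoint)

lemma spline_eq_0:
  assumes "\<And>m. strict_mono (x m)"
    and "\<And>m j. (m, j) \<in> \<Lambda> \<Longrightarrow> u \<notin> {x m j..x m (j + int d + 1)}"
  shows "spline x d \<Lambda> a u = 0"
proof -
  have "bspline (x m) d j u = 0" if "(m, j) \<in> \<Lambda>" for m j
    using assms(2)[OF that] by (intro bspline_eq_0 assms) auto
  then show ?thesis unfolding spline_def by (intro sum.neutral) auto
qed

section \<open>Multilevel partitions\<close>

locale multilevel_partition =
  fixes x :: "int \<Rightarrow> int \<Rightarrow> real" and M0 :: nat and lam :: real
  assumes regular: "regular_multilevel_partition M0 lam x" and lam: "lam \<ge> 1"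
begin

text \<open>The contraction factor for lengths from parent to child, established in
  \<open>child_length_le\<close>.\<close>

definition \<rho> :: real where "\<rho> = lam / (1 + lam)"

lemma \<rho>: "0 < \<rho>" "\<rho> < 1"
  using lam by (auto simp: \<rho>_def field_simps)

lemma strict_mono_nodes: "strict_mono (x m)"
  using regular by (simp add: regular_multilevel_partition_def)

lemma node_less_iff [simp]: "x m i < x m j \<longleftrightarrow> i < j"
  by (rule strict_mono_less[OF strict_mono_nodes])

lemma node_le_iff [simp]: "x m i \<le> x m j \<longleftrightarrow> i \<le> j"
  by (rule strict_mono_less_eq[OF strict_mono_nodes])

lemma ex_interval: "\<exists>j. x m j \<le> u \<and> u < x m (j + 1)"
proof -
  have "u \<in> \<Union> (level_intervals x m)"
    using regular by (simp add: regular_multilevel_partition_def)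
  then obtain j where j: "x m j \<le> u" "u \<le> x m (j + 1)"
    by (auto simp: level_intervals_def)
  show ?thesis
  proof (cases "u = x m (j + 1)")
    case True
    then show ?thesis by (intro exI[of _ "j + 1"]) simp
  qed (use j in force)
qed

lemma length_le: "x m (i + 1) - x m i \<le> lam * (x m (j + 1) - x m j)"
proof -
  have "measure lebesgue {x m i..x m (i + 1)} \<le> lam * measure lebesgue {x m j..x m (j + 1)}"
    using regular by (simp add: regular_multilevel_partition_def level_intervals_def)
  then show ?thesis by simp
qed

lemma ex_parent: "\<exists>p. x m p \<le> x (m + 1) j \<and> x (m + 1) (j + 1) \<le> x m (p + 1)"
proof -
  have "\<exists>I\<in>level_intervals x m. {x (m + 1) j..x (m + 1) (j + 1)} \<subseteq> I"
    using regular by (simp add: regular_multilevel_partition_def level_intervals_def)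
  then show ?thesis by (auto simp: level_intervals_def)
qed

text \<open>The half-open fine cell around \<open>x m j\<close> lies in a single coarse cell. That
  cell must be the one starting at \<open>x m j\<close>, so the fine cell starts there too.\<close>

lemma ex_node_Suc: "\<exists>i. x m j = x (m + 1) i"
proof -
  obtain i where i: "x (m + 1) i \<le> x m j" "x m j < x (m + 1) (i + 1)"
    using ex_interval by blast
  obtain p where p: "x m p \<le> x (m + 1) i" "x (m + 1) (i + 1) \<le> x m (p + 1)"
    using ex_parent by blast
  have "x m p \<le> x m j" "x m j < x m (p + 1)" using i p by linarith+
  then have "p = j" by simp
  then show ?thesis using i p by (intro exI[of _ i]) simp
qed

lemma ex_node: assumes "m \<le> m'" shows "\<exists>i. x m j = x m' i"
  using assms
proof (induction m' rule: int_ge_induct)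
  case (step m')
  then show ?case using ex_node_Suc by metis
qed auto

text \<open>The right end of the coarse cell is itself a node of level \<open>m'\<close>, so a fine
  cell that starts inside cannot cross it.\<close>

lemma ex_ancestor: assumes "m \<le> m'" shows "\<exists>p. x m p \<le> x m' j \<and> x m' (j + 1) \<le> x m (p + 1)"
proof -
  obtain p where p: "x m p \<le> x m' j" "x m' j < x m (p + 1)" using ex_interval by blast
  obtain i where i: "x m (p + 1) = x m' i" using ex_node[OF assms] by blast
  then have "j < i" using p by simp
  then show ?thesis using p i by auto
qed

text \<open>The parent contains a second child, whose length is at least \<open>1 / lam\<close>
  times that of the given one. Thus \<open>1 + 1 / lam\<close> times the length of the child fits
  into the parent.\<close>

lemma child_length_le:
  assumes "x m p \<le> x (m + 1) j" "x (m + 1) (j + 1) \<le> x m (p + 1)"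
  shows "x (m + 1) (j + 1) - x (m + 1) j \<le> \<rho> * (x m (p + 1) - x m p)"
proof -
  let ?C = "{I' \<in> level_intervals x (m + 1). I' \<subseteq> {x m p..x m (p + 1)}}"
  have "2 \<le> card ?C"
    using regular unfolding regular_multilevel_partition_def level_intervals_def by blast
  then have "\<not> ?C \<subseteq> {{x (m + 1) j..x (m + 1) (j + 1)}}"
    using card_mono[of "{{x (m + 1) j..x (m + 1) (j + 1)}}" ?C] by auto
  then obtain I' where I': "I' \<in> level_intervals x (m + 1)" "I' \<subseteq> {x m p..x m (p + 1)}"
    "I' \<noteq> {x (m + 1) j..x (m + 1) (j + 1)}"
    by blast
  then obtain i where "I' = {x (m + 1) i..x (m + 1) (i + 1)}"
    unfolding level_intervals_def by blast
  with I' have i: "{x (m + 1) i..x (m + 1) (i + 1)} \<subseteq> {x m p..x m (p + 1)}" "i \<noteq> j"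
    by auto
  have ip: "x m p \<le> x (m + 1) i" "x (m + 1) (i + 1) \<le> x m (p + 1)" using i(1) by auto
  have "x (m + 1) (i + 1) \<le> x (m + 1) j \<or> x (m + 1) (j + 1) \<le> x (m + 1) i" using i(2) by auto
  then have "(x (m + 1) (i + 1) - x (m + 1) i) + (x (m + 1) (j + 1) - x (m + 1) j) \<le> x m (p + 1) - x m p"
    using ip assms by linarith
  then have "lam * (x (m + 1) (i + 1) - x (m + 1) i) + lam * (x (m + 1) (j + 1) - x (m + 1) j)
      \<le> lam * (x m (p + 1) - x m p)"
    unfolding distrib_left[symmetric] using lam by (intro mult_left_mono) auto
  with length_le[of "m + 1" j i] have "(1 + lam) * (x (m + 1) (j + 1) - x (m + 1) j) \<le> lam * (x m (p + 1) - x m p)"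
    by (simp add: distrib_right)
  then show ?thesis using lam by (simp add: \<rho>_def field_simps)
qed

text \<open>The factor \<open>lam\<close> is paid once, on level \<open>m\<close>, for comparing
  arbitrary cells; every further level contributes a factor \<open>\<rho>\<close>. Therefore cell
  \<open>i\<close> may lie outside cell \<open>j\<close>.\<close>

lemma length_le_descend: "x (m + int s) (i + 1) - x (m + int s) i \<le> lam * \<rho> ^ s * (x m (j + 1) - x m j)"
proof (induction s arbitrary: i)
  case 0
  then show ?case using length_le by simp
next
  case (Suc s)
  obtain p where p: "x (m + int s) p \<le> x (m + int s + 1) i" "x (m + int s + 1) (i + 1) \<le> x (m + int s) (p + 1)"
    using ex_parent by blast
  have "x (m + int s + 1) (i + 1) - x (m + int s + 1) i \<le> \<rho> * (x (m + int s) (p + 1) - x (m + int s) p)"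
    by (rule child_length_le[OF p])
  also have "\<dots> \<le> \<rho> * (lam * \<rho> ^ s * (x m (j + 1) - x m j))"
    using \<rho> by (intro mult_left_mono Suc.IH) auto
  also have "\<dots> = lam * \<rho> ^ Suc s * (x m (j + 1) - x m j)" by simp
  finally show ?case
    unfolding of_nat_Suc add.commute[of 1] add.assoc[symmetric, of m "int s" 1] .
qed

text \<open>Coarse nodes are fine nodes, so one coarse step contains at least one fine step, and
  moving \<open>r\<close> steps on both levels preserves the comparison.\<close>

lemma shift_right:
  assumes "m \<le> m'" "x m' i \<le> x m l"
  shows "x m' (i + int r) \<le> x m (l + int r)"
proof (induction r)
  case (Suc r)
  obtain n where n: "x m (l + int (Suc r)) = x m' n" using ex_node[OF assms(1)] by blast
  have "x m (l + int r) < x m (l + int (Suc r))" by simp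
  with Suc n have "i + int r < n" by (metis node_less_iff order_le_less_trans)
  then have "i + int (Suc r) \<le> n" by simp
  then show ?case unfolding n by (simp only: node_le_iff)
qed (use assms in simp)

lemma shift_left:
  assumes "m \<le> m'" "x m l \<le> x m' i"
  shows "x m (l - int r) \<le> x m' (i - int r)"
proof (induction r)
  case (Suc r)
  obtain n where n: "x m (l - int (Suc r)) = x m' n" using ex_node[OF assms(1)] by blast
  have "x m (l - int (Suc r)) < x m (l - int r)" by simp
  with Suc n have "n < i - int r" by (metis node_less_iff order_less_le_trans)
  then have "n \<le> i - int (Suc r)" by simp
  then show ?case unfolding n by (simp only: node_le_iff)
qed (use assms in simp)

lemma length_r_le: "x (m + int s) (i + int r) - x (m + int s) i \<le> real r * (lam * \<rho> ^ s * (x m (j + 1) - x m j))"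
proof (induction r)
  case (Suc r)
  have "x (m + int s) (i + int (Suc r)) - x (m + int s) i =
     (x (m + int s) (i + int r + 1) - x (m + int s) (i + int r)) + (x (m + int s) (i + int r) - x (m + int s) i)"
    by (simp add: algebra_simps)
  also have "\<dots> \<le> lam * \<rho> ^ s * (x m (j + 1) - x m j) + real r * (lam * \<rho> ^ s * (x m (j + 1) - x m j))"
    by (intro add_mono Suc length_le_descend)
  finally show ?case by (simp add: algebra_simps)
qed simp

text \<open>\<open>anc s m j\<close> is the index, on level \<open>m - s\<close>, of the ancestor of the \<open>j\<close>-th interval of level \<open>m\<close>.\<close>

fun anc :: "nat \<Rightarrow> int \<Rightarrow> int \<Rightarrow> int" where
  "anc 0 m j = j"
| "anc (Suc s) m j = (SOME p. x (m - int s - 1) p \<le> x (m - int s) (anc s m j) \<and>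
     x (m - int s) (anc s m j + 1) \<le> x (m - int s - 1) (p + 1))"

lemma anc_Suc:
  "x (m - int s - 1) (anc (Suc s) m j) \<le> x (m - int s) (anc s m j)"
  "x (m - int s) (anc s m j + 1) \<le> x (m - int s - 1) (anc (Suc s) m j + 1)"
proof -
  have "\<exists>p. x (m - int s - 1) p \<le> x (m - int s) (anc s m j) \<and>
     x (m - int s) (anc s m j + 1) \<le> x (m - int s - 1) (p + 1)"
    using ex_parent[of "m - int s - 1" "anc s m j"] by (simp only: diff_add_cancel)
  from someI_ex[OF this]
  show "x (m - int s - 1) (anc (Suc s) m j) \<le> x (m - int s) (anc s m j)"
    and "x (m - int s) (anc s m j + 1) \<le> x (m - int s - 1) (anc (Suc s) m j + 1)"
    by (simp_all only: anc.simps(2))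
qed

declare anc.simps(2) [simp del]

text \<open>The windows of successive ancestors are nested: the inclusion of the cells is carried
  \<open>k - 1\<close> steps outwards by \<open>shift_left\<close> and
  \<open>shift_right\<close>.\<close>

lemma anc_window:
  assumes k: "k \<ge> 1" and "s \<le> s'"
  shows "x (m - int s') (anc s' m j + 1 - int k) \<le> x (m - int s) (anc s m j + 1 - int k)"
    and "x (m - int s) (anc s m j + int k) \<le> x (m - int s') (anc s' m j + int k)"
proof -
  have l: "x (m - int s - 1) (anc (Suc s) m j + 1 - int k) \<le> x (m - int s) (anc s m j + 1 - int k)"
    and r: "x (m - int s) (anc s m j + int k) \<le> x (m - int s - 1) (anc (Suc s) m j + int k)" for s
  proof -
    obtain r where Suc: "k = Suc r" using k by (cases k) auto
    show "x (m - int s - 1) (anc (Suc s) m j + 1 - int k) \<le> x (m - int s) (anc s m j + 1 - int k)"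
      using shift_left[OF _ anc_Suc(1)[of m s j], of r] Suc by simp
    show "x (m - int s) (anc s m j + int k) \<le> x (m - int s - 1) (anc (Suc s) m j + int k)"
      using shift_right[OF _ anc_Suc(2)[of m s j], of r] Suc by (simp add: algebra_simps)
  qed
  show "x (m - int s') (anc s' m j + 1 - int k) \<le> x (m - int s) (anc s m j + 1 - int k)"
    using assms(2)
  proof (induction s' rule: dec_induct)
    case (step n)
    then show ?case using order_trans[OF l[of n]] by (simp add: diff_diff_eq add.commute[of 1])
  qed simp
  show "x (m - int s) (anc s m j + int k) \<le> x (m - int s') (anc s' m j + int k)"
    using assms(2)
  proof (induction s' rule: dec_induct)
    case (step n)
    then show ?case using order_trans[OF _ r[of n]] by (simp add: diff_diff_eq add.commute[of 1])
  qed simp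
qed

text \<open>\<open>meets\<close>: the support of the B-spline \<open>(m', i)\<close> meets \<open>\<Omega>\<close> of the interval \<open>(m, j)\<close>.\<close>

definition meets :: "nat \<Rightarrow> int \<Rightarrow> int \<Rightarrow> int \<times> int \<Rightarrow> bool" where
  "meets k m j Q \<longleftrightarrow> x m (j + 1 - int k) \<le> x (fst Q) (snd Q + int k) \<and> x (fst Q) (snd Q) \<le> x m (j + int k)"

text \<open>The support of a B-spline of level at least \<open>m\<close> lies within
  \<open>k + 1\<close> consecutive cells of level \<open>m\<close>, which leaves
  \<open>3 * k + 1\<close> possible indices \<open>j\<close>.\<close>

lemma card_meets:
  assumes "m \<le> fst Q"
  shows "finite {j. meets k m j Q}" "card {j. meets k m j Q} \<le> 3 * k + 1"
proof -
  obtain l where l: "x m l \<le> x (fst Q) (snd Q)" "x (fst Q) (snd Q) < x m (l + 1)" using ex_interval by blast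
  have r: "x (fst Q) (snd Q + int k) \<le> x m (l + 1 + int k)"
    using shift_right[OF assms, of "snd Q" "l + 1" k] l by simp
  have sub: "{j. meets k m j Q} \<subseteq> {l - int k..l + 2 * int k}"
  proof
    fix j assume "j \<in> {j. meets k m j Q}"
    then have "x m (j + 1 - int k) \<le> x (fst Q) (snd Q + int k)" "x (fst Q) (snd Q) \<le> x m (j + int k)"
      by (auto simp: meets_def)
    with l r have "x m (j + 1 - int k) \<le> x m (l + 1 + int k)" "x m l \<le> x m (j + int k)" by linarith+
    then show "j \<in> {l - int k..l + 2 * int k}" by simp
  qed
  show "finite {j. meets k m j Q}" using sub by (rule finite_subset) simp
  have "card {j. meets k m j Q} \<le> card {l - int k..l + 2 * int k}" using sub by (intro card_mono) auto
  then show "card {j. meets k m j Q} \<le> 3 * k + 1" by simp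
qed

text \<open>The coarse node is some \<open>x m i\<close>, and it lies in the window of
  \<open>j\<close> exactly for \<open>i - k \<le> j \<le> i + k - 1\<close>.\<close>

lemma card_windows_at_node:
  assumes "m' \<le> m"
  shows "finite {j. x m (j + 1 - int k) \<le> x m' l \<and> x m' l \<le> x m (j + int k)}"
    and "card {j. x m (j + 1 - int k) \<le> x m' l \<and> x m' l \<le> x m (j + int k)} \<le> 2 * k"
proof -
  obtain i where i: "x m' l = x m i" using ex_node[OF assms] by blast
  have sub: "{j. x m (j + 1 - int k) \<le> x m' l \<and> x m' l \<le> x m (j + int k)} = {i - int k..i + int k - 1}"
    by (auto simp: i)
  show "finite {j. x m (j + 1 - int k) \<le> x m' l \<and> x m' l \<le> x m (j + int k)}" unfolding sub by simp
  show "card {j. x m (j + 1 - int k) \<le> x m' l \<and> x m' l \<le> x m (j + int k)} \<le> 2 * k" unfolding sub by simp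
qed

end

section \<open>Moduli of smoothness\<close>

text \<open>The bridge from the integrals in the definitions to the gauge integrals in which all
  estimates are carried out.\<close>

lemma set_nn_integral_eq_integral:
  fixes f :: "real \<Rightarrow> real"
  assumes "continuous_on {a..b} f" "\<And>x. 0 \<le> f x"
  shows "(\<integral>\<^sup>+x\<in>{a..b}. ennreal (f x) \<partial>lebesgue) = ennreal (integral {a..b} f)"
proof -
  have "(f has_integral integral {a..b} f) {a..b}"
    using assms by (intro integrable_integral integrable_continuous_real)
  from nn_integral_has_integral_lebesgue[OF assms(2) this]
  have "(\<integral>\<^sup>+x. ennreal (indicator {a..b} x * f x) \<partial>lborel) = ennreal (integral {a..b} f)" .
  also have "(\<integral>\<^sup>+x. ennreal (indicator {a..b} x * f x) \<partial>lborel) = (\<integral>\<^sup>+x\<in>{a..b}. ennreal (f x) \<partial>lborel)"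
    by (intro nn_integral_cong) (auto simp: indicator_def)
  finally show ?thesis by (simp add: nn_integral_completion)
qed

lemma interval_avg_eq_avg:
  assumes "continuous_on {a..b} f"
  shows "interval_avg a b f = avg a b f"
proof -
  have "f absolutely_integrable_on {a..b}"
    using absolutely_integrable_continuous[of a b f] assms by simp
  then show ?thesis
    unfolding interval_avg_def avg_def by (simp add: set_lebesgue_integral_eq_integral(2))
qed

lemma bmo_normD:
  assumes cont: "continuous_on UNIV f" and B: "bmo_norm f \<le> ennreal B" "B \<ge> 0" and ab: "a < b"
  shows "integral {a..b} (\<lambda>x. norm (f x - avg a b f)) \<le> B * (b - a)"
proof -
  have cf: "continuous_on S f" for S
    using cont continuous_on_subset by blast
  let ?I = "integral {a..b} (\<lambda>x. norm (f x - avg a b f))"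
  have I: "?I \<ge> 0" by (intro integral_nonneg integrable_continuous_real continuous_intros cf) auto
  have "ennreal (1 / (b - a)) * (\<integral>\<^sup>+ x \<in> {a..b}. ennreal (norm (f x - interval_avg a b f)) \<partial>lebesgue) \<le> bmo_norm f"
    unfolding bmo_norm_def using ab by (intro SUP_upper2[of "(a, b)"]) auto
  also have "(\<integral>\<^sup>+ x \<in> {a..b}. ennreal (norm (f x - interval_avg a b f)) \<partial>lebesgue) = ennreal ?I"
    unfolding interval_avg_eq_avg[OF cf] by (intro set_nn_integral_eq_integral continuous_intros cf) auto
  finally have "ennreal (?I / (b - a)) \<le> bmo_norm f"
    using ab I by (simp flip: ennreal_mult)
  then have "ennreal (?I / (b - a)) \<le> ennreal B" using B by order
  then have "?I / (b - a) \<le> B" using B by simp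
  then show ?thesis using ab by (simp add: field_simps)
qed

lemma ennreal_powr_ennreal [simp]: "r \<ge> 0 \<Longrightarrow> ennreal_powr (ennreal r) p = ennreal (r powr p)"
  by (simp add: ennreal_powr_def)

lemma ennreal_powr_mono:
  assumes "a \<le> b" "p \<ge> 0"
  shows "ennreal_powr a p \<le> ennreal_powr b p"
proof (cases b)
  case (real r)
  then obtain s where "a = ennreal s" "s \<ge> 0"
    using assms by (metis ennreal_cases ennreal_less_top leD less_top)
  then show ?thesis using assms real by (auto intro!: powr_mono2)
qed (simp add: ennreal_powr_def)

text \<open>The binomial coefficients sum to \<open>2 ^ k\<close>, and the power of the largest norm
  is one of the summands on the right.\<close>

lemma norm_binomial_sum_powr_le:
  fixes v :: "nat \<Rightarrow> complex"
  assumes "q > 0"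
  shows "norm (\<Sum>i=0..k. (- 1) ^ (k + i) * of_nat (k choose i) * v i) powr q \<le>
    (2 ^ k) powr q * (\<Sum>i=0..k. norm (v i) powr q)"
proof -
  define M where "M = Max ((\<lambda>i. norm (v i)) ` {0..k})"
  have M: "norm (v i) \<le> M" if "i \<in> {0..k}" for i
    unfolding M_def using that by (intro Max_ge) auto
  have "M \<in> (\<lambda>i. norm (v i)) ` {0..k}" unfolding M_def by (intro Max_in) auto
  then obtain i0 where i0: "i0 \<in> {0..k}" "M = norm (v i0)" by auto
  have "norm (\<Sum>i=0..k. (- 1) ^ (k + i) * of_nat (k choose i) * v i) \<le> (\<Sum>i=0..k. real (k choose i) * M)"
    by (intro sum_norm_le) (auto simp: norm_mult norm_power intro!: mult_left_mono M)
  also have "\<dots> = 2 ^ k * M"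
  proof -
    have "(\<Sum>i=0..k. real (k choose i)) = 2 ^ k"
      using choose_row_sum[of k] by (simp add: atLeast0AtMost flip: of_nat_sum)
    then show ?thesis by (simp add: sum_distrib_right[symmetric])
  qed
  finally have "norm (\<Sum>i=0..k. (- 1) ^ (k + i) * of_nat (k choose i) * v i) powr q \<le> (2 ^ k * M) powr q"
    using assms by (intro powr_mono2) auto
  also have "\<dots> = (2 ^ k) powr q * norm (v i0) powr q"
    using i0 by (simp add: powr_mult)
  also have "norm (v i0) powr q \<le> (\<Sum>i=0..k. norm (v i) powr q)"
    using i0 by (intro member_le_sum) auto
  finally show ?thesis by (simp add: mult_left_mono)
qed

lemma nn_integral_translate:
  fixes G :: "real \<Rightarrow> ennreal"
  assumes "G \<in> borel_measurable borel"
  shows "(\<integral>\<^sup>+x. G (x + c) \<partial>lebesgue) = (\<integral>\<^sup>+x. G x \<partial>lebesgue)"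
  using nn_integral_real_affine[OF assms, of 1 c] by (simp add: nn_integral_completion add.commute)

definition diff_const :: "nat \<Rightarrow> real \<Rightarrow> real" where
  "diff_const k q = (2 ^ k) powr q * real (Suc k)"

text \<open>The elementary half of Whitney's equivalence: the difference of order \<open>k\<close>
  annihilates \<open>p\<close>, so it may be applied to \<open>f - p\<close>, and each of its
  \<open>Suc k\<close> translates costs at most one integral over the interval.\<close>

lemma modulus_smoothness_le:
  assumes cont: "continuous_on UNIV f" and q: "q > 0" and p: "degree p < k"
  shows "modulus_smoothness k q f {a..b} \<le>
    ennreal ((diff_const k q * integral {a..b} (\<lambda>u. norm (f u - poly p (of_real u)) powr q)) powr (1 / q))"
proof -
  define g where "g u = norm (f u - poly p (of_real u)) powr q" for u
  have cg: "continuous_on S g" for S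
    unfolding g_def using q cont continuous_on_subset
    by (intro continuous_on_norm_diff_powr continuous_intros) auto
  have g0: "g u \<ge> 0" for u by (simp add: g_def)
  \<comment> \<open>Extension by zero makes translation invariance on the whole line
    available.\<close>
  define G where "G u = ennreal (g u) * indicator {a..b} u" for u
  have "g \<in> borel_measurable borel" by (intro borel_measurable_continuous_onI cg)
  then have Gm: "G \<in> borel_measurable borel" unfolding G_def by measurable
  define D where "D = (2 ^ k :: real) powr q"
  have I: "(\<integral>\<^sup>+u. G u \<partial>lebesgue) = ennreal (integral {a..b} g)"
    unfolding G_def by (intro set_nn_integral_eq_integral cg g0)
  have I0: "integral {a..b} g \<ge> 0"
    by (intro integral_nonneg integrable_continuous_real cg g0)
  have "(\<integral>\<^sup>+u\<in>{a..b}. ennreal (norm (fin_diff k h f {a..b} u) powr q) \<partial>lebesgue) \<le>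
      ennreal (diff_const k q * integral {a..b} g)" for h
  proof -
    have "ennreal (norm (fin_diff k h f {a..b} u) powr q) * indicator {a..b} u \<le>
        ennreal D * (\<Sum>i=0..k. G (u + real i * h))" for u
    proof (cases "closed_segment u (u + real k * h) \<subseteq> {a..b}")
      case False
      then show ?thesis using q by (simp add: fin_diff_def)
    next
      case True
      \<comment> \<open>All points of evaluation lie on the segment and hence in the interval, where
        \<open>G\<close> agrees with \<open>g\<close>.\<close>
      have inn: "u + real i * h \<in> {a..b}" if "i \<in> {0..k}" for i
      proof -
        have "u + real i * h \<in> closed_segment u (u + real k * h)"
        proof (cases "k = 0")
          case False
          have "u + real i * h = (1 - real i / real k) *\<^sub>R u + (real i / real k) *\<^sub>R (u + real k * h)"
            using False by (simp add: field_simps)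
          moreover have "0 \<le> real i / real k" "real i / real k \<le> 1" using that False by auto
          ultimately show ?thesis unfolding in_segment by blast
        qed (use that in auto)
        with True show ?thesis by blast
      qed
      have "(\<Sum>i=0..k. (- 1) ^ (k + i) * of_nat (k choose i) * f (u + real i * h)) =
          (\<Sum>i=0..k. (- 1) ^ (k + i) * of_nat (k choose i) *
             (f (u + real i * h) - poly p (of_real (u + real i * h))))"
        using difference_poly_eq_0[OF p, of "of_real u" "of_real h"]
        by (simp add: right_diff_distrib sum_subtractf)
      then have "norm (fin_diff k h f {a..b} u) powr q \<le> D * (\<Sum>i=0..k. g (u + real i * h))"
        using norm_binomial_sum_powr_le[OF q] True unfolding fin_diff_def g_def D_def by simp
      then have "ennreal (norm (fin_diff k h f {a..b} u) powr q) \<le> ennreal (D * (\<Sum>i=0..k. g (u + real i * h)))"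
        by (rule ennreal_leI)
      also have "\<dots> = ennreal D * (\<Sum>i=0..k. ennreal (g (u + real i * h)))"
        by (subst ennreal_mult) (auto simp: D_def g0 sum_nonneg sum_ennreal)
      also have "(\<Sum>i=0..k. ennreal (g (u + real i * h))) = (\<Sum>i=0..k. G (u + real i * h))"
        using inn by (intro sum.cong) (auto simp: G_def)
      finally show ?thesis by (auto simp: indicator_def)
    qed
    then have "(\<integral>\<^sup>+u\<in>{a..b}. ennreal (norm (fin_diff k h f {a..b} u) powr q) \<partial>lebesgue) \<le>
        (\<integral>\<^sup>+u. ennreal D * (\<Sum>i=0..k. G (u + real i * h)) \<partial>lebesgue)"
      by (intro nn_integral_mono)
    also have "\<dots> = ennreal D * (\<Sum>i=0..k. (\<integral>\<^sup>+u. G (u + real i * h) \<partial>lebesgue))"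
    proof -
      have m: "(\<lambda>u. G (u + c)) \<in> borel_measurable borel" for c
        using measurable_compose[OF _ Gm, of "\<lambda>u. u + c" borel] by simp
      show ?thesis unfolding nn_integral_completion
        by (subst nn_integral_cmult) (simp_all add: m nn_integral_sum borel_measurable_sum)
    qed
    also have "\<dots> = ennreal D * (of_nat (Suc k) * ennreal (integral {a..b} g))"
      unfolding nn_integral_translate[OF Gm] I by simp
    also have "\<dots> = ennreal (diff_const k q * integral {a..b} g)"
      unfolding diff_const_def D_def[symmetric] ennreal_of_nat_eq_real_of_nat
      using I0 by (simp add: ennreal_mult D_def mult.assoc del: of_nat_Suc)
    finally show ?thesis .
  qed
  note h_bound = this
  have C: "diff_const k q * integral {a..b} g \<ge> 0"
    using I0 by (simp add: diff_const_def)
  have "Lq_norm_on q {a..b} (fin_diff k h f {a..b}) \<le>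
     ennreal ((diff_const k q * integral {a..b} g) powr (1 / q))" for h
  proof -
    have "0 \<le> 1 / q" using q by simp
    then have "Lq_norm_on q {a..b} (fin_diff k h f {a..b}) \<le>
        ennreal_powr (ennreal (diff_const k q * integral {a..b} g)) (1 / q)"
      unfolding Lq_norm_on_def by (rule ennreal_powr_mono[OF h_bound])
    then show ?thesis by (simp only: ennreal_powr_ennreal[OF C])
  qed
  then show ?thesis unfolding modulus_smoothness_def g_def by (intro SUP_least)
qed

lemma besov_term_le:
  assumes cont: "continuous_on UNIV f" and q: "q > 0" and p: "degree p < k" and L: "L > 0" and \<tau>: "\<tau> \<ge> 0"
  shows "ennreal_powr (ennreal (L powr (- 1 / q)) * modulus_smoothness k q f {a..b}) \<tau> \<le>
    ennreal ((diff_const k q * (integral {a..b} (\<lambda>u. norm (f u - poly p (of_real u)) powr q) / L)) powr (\<tau> / q))"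
proof -
  define I where "I = diff_const k q * integral {a..b} (\<lambda>u. norm (f u - poly p (of_real u)) powr q)"
  have I: "I \<ge> 0" unfolding I_def diff_const_def using q
    by (intro mult_nonneg_nonneg integral_nonneg integrable_continuous_real continuous_on_norm_diff_powr
        continuous_intros continuous_on_subset[OF cont]) auto
  have "ennreal (L powr (- 1 / q)) * modulus_smoothness k q f {a..b} \<le>
      ennreal (L powr (- 1 / q)) * ennreal (I powr (1 / q))"
    unfolding I_def by (intro mult_left_mono modulus_smoothness_le cont q p) auto
  also have "\<dots> = ennreal ((I / L) powr (1 / q))"
    using L I by (simp add: powr_divide powr_minus_divide flip: ennreal_mult)
  finally have "ennreal_powr (ennreal (L powr (- 1 / q)) * modulus_smoothness k q f {a..b}) \<tau> \<le>
      ennreal_powr (ennreal ((I / L) powr (1 / q))) \<tau>"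
    using \<tau> by (rule ennreal_powr_mono)
  also have "\<dots> = ennreal ((I / L) powr (\<tau> / q))"
    by (simp add: powr_powr)
  finally show ?thesis by (simp add: I_def)
qed

section \<open>Coarse and fine parts of a spline\<close>

text \<open>The constant of \<open>poly_bound_of_separated_points\<close> for degree
  \<open>k - 1\<close> and relative separation \<open>1 / (2 * k)\<close>. Fixing it by choice makes
  all later constants functions of the parameters alone.\<close>

definition markov_const :: "nat \<Rightarrow> real" where
  "markov_const k = (SOME A. A > 0 \<and> (\<forall>(p :: complex poly) a b Y M.
    degree p \<le> k - 1 \<longrightarrow> a < b \<longrightarrow> Y \<subseteq> {a..b} \<longrightarrow> card Y = Suc (k - 1) \<longrightarrow>
    (\<forall>y\<in>Y. \<forall>y'\<in>Y. y \<noteq> y' \<longrightarrow> 1 / (2 * real k) * (b - a) \<le> \<bar>y - y'\<bar>) \<longrightarrow>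
    (\<forall>y\<in>Y. norm (poly p (of_real y)) \<le> M) \<longrightarrow>
    (\<forall>u\<in>{a..b}. norm (poly p (of_real u)) \<le> A * M) \<and>
    (\<forall>u\<in>{a..b}. \<forall>v\<in>{a..b}.
       norm (poly p (of_real u) - poly p (of_real v)) \<le> A * M * \<bar>u - v\<bar> / (b - a))))"

lemma markov_const:
  fixes p :: "complex poly"
  assumes "k \<ge> 1"
  shows "markov_const k > 0"
    and "\<lbrakk>degree p \<le> k - 1; a < b; Y \<subseteq> {a..b}; card Y = k;
      \<forall>y\<in>Y. \<forall>y'\<in>Y. y \<noteq> y' \<longrightarrow> 1 / (2 * real k) * (b - a) \<le> \<bar>y - y'\<bar>;
      \<forall>y\<in>Y. norm (poly p (of_real y)) \<le> M\<rbrakk> \<Longrightarrow>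
      (\<forall>u\<in>{a..b}. norm (poly p (of_real u)) \<le> markov_const k * M) \<and>
      (\<forall>u\<in>{a..b}. \<forall>v\<in>{a..b}.
         norm (poly p (of_real u) - poly p (of_real v)) \<le> markov_const k * M * \<bar>u - v\<bar> / (b - a))"
proof -
  have k: "1 / (2 * real k) > 0" "Suc (k - 1) = k" using assms by auto
  note * = someI_ex[OF poly_bound_of_separated_points[OF k(1), of "k - 1"], folded markov_const_def]
  show "markov_const k > 0" using * by (rule conjunct1)
  show "(\<forall>u\<in>{a..b}. norm (poly p (of_real u)) \<le> markov_const k * M) \<and>
      (\<forall>u\<in>{a..b}. \<forall>v\<in>{a..b}.
         norm (poly p (of_real u) - poly p (of_real v)) \<le> markov_const k * M * \<bar>u - v\<bar> / (b - a))"
    if "degree p \<le> k - 1" "a < b" "Y \<subseteq> {a..b}" "card Y = k"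
      "\<forall>y\<in>Y. \<forall>y'\<in>Y. y \<noteq> y' \<longrightarrow> 1 / (2 * real k) * (b - a) \<le> \<bar>y - y'\<bar>"
      "\<forall>y\<in>Y. norm (poly p (of_real y)) \<le> M"
    using conjunct2[OF *, THEN spec[of _ p], THEN spec[of _ a], THEN spec[of _ b], THEN spec[of _ Y],
        THEN spec[of _ M]] that unfolding k(2)
    by (elim impE) assumption+
qed

lemma integral_indicator_Icc_le:
  fixes a b c d :: real
  assumes "a \<le> b"
  shows "(indicator {a..b} :: real \<Rightarrow> real) integrable_on {c..d}"
    and "integral {c..d} (indicator {a..b} :: real \<Rightarrow> real) \<le> b - a"
proof -
  have eq: "(indicator {a..b} :: real \<Rightarrow> real) = (\<lambda>x. if x \<in> {a..b} then 1 else 0)"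
    by (auto simp: indicator_def)
  have i: "{a..b} \<inter> {c..d} = {max a c..min b d}" by auto
  show "(indicator {a..b} :: real \<Rightarrow> real) integrable_on {c..d}"
    unfolding eq integrable_restrict_Int i by (rule integrable_const_ivl)
  show "integral {c..d} (indicator {a..b} :: real \<Rightarrow> real) \<le> b - a"
    unfolding eq integral_restrict_Int i using assms by (auto simp: min_def max_def)
qed

text \<open>Lipschitz bounds on adjacent intervals glue at the common end point without loss in the
  constant.\<close>

lemma norm_diff_le_concat:
  fixes f :: "real \<Rightarrow> complex"
  assumes "\<And>u v. u \<in> {a..b} \<Longrightarrow> v \<in> {a..b} \<Longrightarrow> norm (f u - f v) \<le> K * \<bar>u - v\<bar>"
    and "\<And>u v. u \<in> {b..c} \<Longrightarrow> v \<in> {b..c} \<Longrightarrow> norm (f u - f v) \<le> K * \<bar>u - v\<bar>"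
    and ab: "a \<le> b" "b \<le> c" and "u \<in> {a..c}" "v \<in> {a..c}"
  shows "norm (f u - f v) \<le> K * \<bar>u - v\<bar>"
proof -
  have *: "norm (f u - f v) \<le> K * \<bar>u - v\<bar>" if uv: "u \<le> b" "b \<le> v" "u \<in> {a..c}" "v \<in> {a..c}" for u v
  proof -
    have "norm (f u - f v) \<le> norm (f u - f b) + norm (f b - f v)"
      using norm_triangle_ineq[of "f u - f b" "f b - f v"] by simp
    also have "\<dots> \<le> K * \<bar>u - b\<bar> + K * \<bar>b - v\<bar>"
      using uv ab by (intro add_mono assms) auto
    also have "\<dots> = K * \<bar>u - v\<bar>" using uv by (simp add: algebra_simps)
    finally show ?thesis .
  qed
  consider "u \<le> b" "v \<le> b" | "u \<le> b" "b \<le> v" | "b \<le> u" "v \<le> b" | "b \<le> u" "b \<le> v" by linarith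
  then show ?thesis
  proof cases
    case 3
    then show ?thesis using *[of v u] assms(5,6) by (simp add: norm_minus_commute abs_minus_commute)
  qed (use assms * in auto)
qed

text \<open>\<open>B\<close> is a positive bound for the BMO norm instead of the norm itself, so
  that it can be divided by; the final theorem lets it decrease to the norm.\<close>

locale nterm_spline = multilevel_partition +
  fixes k :: nat and \<Lambda> :: "(int \<times> int) set" and coef :: "int \<times> int \<Rightarrow> complex" and B q :: real
  assumes k: "k \<ge> 2" and fin: "finite \<Lambda>" and B: "B > 0" and q: "q > 0"
    and bmo: "bmo_norm (spline x (k - 1) \<Lambda> coef) \<le> ennreal B"
begin

definition g :: "real \<Rightarrow> complex" where "g = spline x (k - 1) \<Lambda> coef"

definition coarse :: "int \<Rightarrow> real \<Rightarrow> complex" where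
  "coarse m = spline x (k - 1) {Q \<in> \<Lambda>. fst Q < m} coef"

definition window_left :: "int \<Rightarrow> int \<Rightarrow> real" where "window_left m j = x m (j + 1 - int k)"
definition window_right :: "int \<Rightarrow> int \<Rightarrow> real" where "window_right m j = x m (j + int k)"

definition cell_length :: "int \<Rightarrow> int \<Rightarrow> real" where "cell_length m j = x m (j + 1) - x m j"

definition finer :: "int \<Rightarrow> int \<Rightarrow> (int \<times> int) set" where
  "finer m j = {Q \<in> \<Lambda>. m \<le> fst Q \<and> meets k m j Q}"

definition fine_weight :: "int \<Rightarrow> int \<Rightarrow> real" where "fine_weight m j = (\<Sum>Q\<in>finer m j. \<rho> ^ nat (fst Q - m))"

text \<open>The supports are counted with multiplicity: the integral is then additive over them, and
  \<open>cover_ge_1\<close> still detects every point where \<open>g\<close> differs from its coarse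
  part.\<close>

definition cover :: "int \<Rightarrow> int \<Rightarrow> real \<Rightarrow> real" where
  "cover m j u = (\<Sum>Q\<in>finer m j. indicator {x (fst Q) (snd Q)..x (fst Q) (snd Q + int k)} u)"

text \<open>
  Below this weight the finer supports cover at most a third of each of the \<open>2 * k\<close> subintervals
  of equal length of a cell, so that every subinterval contains points where \<open>g\<close> equals its
  coarse part.
\<close>

definition threshold :: real where "threshold = 1 / (6 * real k ^ 2 * lam)"

text \<open>The second factor, times \<open>B\<close>, is the deviation allowed at the points of
  \<open>ex_sample_point\<close>; the first carries it to the whole cell.\<close>

definition sup_const :: real where "sup_const = markov_const k * (12 * real k ^ 2 * lam)"

lemma k1: "k \<ge> 1" "k - 1 \<ge> 1" "int (k - 1) + 1 = int k" using k by auto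

lemma cell_length_pos: "cell_length m j > 0" by (simp add: cell_length_def)

lemma window_left_less_right: "window_left m j < window_right m j" using k by (simp add: window_left_def window_right_def)

lemma threshold: "0 < threshold" "threshold \<le> 1"
proof -
  have "1 \<le> real k ^ 2" using k by simp
  then have "1 * 1 \<le> real k ^ 2 * lam" using lam by (intro mult_mono) auto
  then show "0 < threshold" "threshold \<le> 1" by (auto simp: threshold_def field_simps)
qed

lemma sup_const: "sup_const > 0"
  using markov_const(1)[OF k1(1)] k lam by (simp add: sup_const_def)

lemma finite_finer: "finite (finer m j)" using fin by (simp add: finer_def)

lemma fine_weight_nonneg: "fine_weight m j \<ge> 0" unfolding fine_weight_def using \<rho> by (intro sum_nonneg) auto

lemma continuous_on_g: "continuous_on S g"
  unfolding g_def by (intro continuous_on_spline strict_mono_nodes k1)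

lemma continuous_on_coarse: "continuous_on S (coarse m)"
  unfolding coarse_def by (intro continuous_on_spline strict_mono_nodes k1)

lemma bounded_g: "\<exists>N. \<forall>u. norm (g u) \<le> N"
  unfolding g_def by (intro bounded_spline strict_mono_nodes k1)

lemma bmo_g: "a < b \<Longrightarrow> integral {a..b} (\<lambda>u. norm (g u - avg a b g)) \<le> B * (b - a)"
  using bmo B by (intro bmo_normD continuous_on_g) (auto simp: g_def)

lemma jn_g:
  assumes "r > 0" "a < b"
  shows "integral {a..b} (\<lambda>u. norm (g u - avg a b g) powr r) \<le> jn_const r * B powr r * (b - a)"
proof -
  obtain N where "\<And>u. norm (g u) \<le> N" using bounded_g by blast
  then show ?thesis using assms by (intro john_nirenberg[of g N] continuous_on_g B bmo_g) auto
qed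

lemma window_length_le: "window_right m j - window_left m j \<le> 2 * real k * lam * cell_length m i"
proof -
  have "x (m + int 0) (j + 1 - int k + int (2 * k - 1)) - x (m + int 0) (j + 1 - int k) \<le>
      real (2 * k - 1) * (lam * \<rho> ^ 0 * (x m (i + 1) - x m i))"
    by (rule length_r_le)
  moreover have "j + 1 - int k + int (2 * k - 1) = j + int k" using k by auto
  ultimately have "window_right m j - window_left m j \<le> real (2 * k - 1) * (lam * cell_length m i)"
    by (simp add: window_left_def window_right_def cell_length_def add.commute)
  also have "\<dots> \<le> 2 * real k * (lam * cell_length m i)"
    using cell_length_pos[of m i] lam by (intro mult_right_mono) auto
  finally show ?thesis by (simp add: mult.assoc)
qed

text \<open>\<open>coarse (m + 1)\<close> involves levels up to \<open>m\<close> only, and a cell of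
  level \<open>m\<close> lies within a single cell of each of them.\<close>

lemma coarse_poly:
  "\<exists>p. degree p \<le> k - 1 \<and> (\<forall>u\<in>{x m l..x m (l + 1)}. coarse (m + 1) u = poly p (of_real u))"
proof -
  let ?F = "{Q \<in> \<Lambda>. fst Q < m + 1}"
  have "\<forall>Q\<in>?F. \<exists>p :: complex poly. degree p \<le> k - 1 \<and>
      (\<forall>u\<in>{x m l..<x m (l + 1)}. of_real (bspline (x (fst Q)) (k - 1) (snd Q) u) = poly p (of_real u))"
  proof
    fix Q assume Q: "Q \<in> ?F"
    obtain i where "x (fst Q) i \<le> x m l" "x m (l + 1) \<le> x (fst Q) (i + 1)"
      using ex_ancestor[of "fst Q" m l] Q by auto
    then have sub: "{x m l..<x m (l + 1)} \<subseteq> {x (fst Q) i..<x (fst Q) (i + 1)}" by auto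
    obtain p :: "complex poly" where "degree p \<le> k - 1" "\<forall>u\<in>{x (fst Q) i..<x (fst Q) (i + 1)}.
        of_real (bspline (x (fst Q)) (k - 1) (snd Q) u) = poly p (of_real u)"
      using bspline_piecewise_poly[OF strict_mono_nodes[of "fst Q"]] by blast
    with sub show "\<exists>p :: complex poly. degree p \<le> k - 1 \<and>
      (\<forall>u\<in>{x m l..<x m (l + 1)}. of_real (bspline (x (fst Q)) (k - 1) (snd Q) u) = poly p (of_real u))"
      by blast
  qed
  from bchoice[OF this] obtain P :: "int \<times> int \<Rightarrow> complex poly" where P: "\<And>Q. Q \<in> ?F \<Longrightarrow> degree (P Q) \<le> k - 1"
    "\<And>Q u. Q \<in> ?F \<Longrightarrow> u \<in> {x m l..<x m (l + 1)} \<Longrightarrow>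
      of_real (bspline (x (fst Q)) (k - 1) (snd Q) u) = poly (P Q) (of_real u)"
    by blast
  define p where "p = (\<Sum>Q\<in>?F. smult (coef Q) (P Q))"
  have "degree p \<le> k - 1"
    unfolding p_def using fin P(1) by (intro degree_sum_le order_trans[OF degree_smult_le]) auto
  moreover have "coarse (m + 1) u = poly p (of_real u)" if u: "u \<in> {x m l..x m (l + 1)}" for u
  proof -
    let ?d = "\<lambda>u. coarse (m + 1) u - poly p (of_real u)"
    \<comment> \<open>The identity on the half-open cell extends to its right end by
      continuity.\<close>
    have "?d u = 0"
    proof (rule continuous_constant_on_closure[of "{x m l..<x m (l + 1)}" ?d 0])
      show "continuous_on (closure {x m l..<x m (l + 1)}) ?d"
        by (intro continuous_intros continuous_on_coarse)
      show "?d v = 0" if "v \<in> {x m l..<x m (l + 1)}" for v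
        using P(2)[OF _ that] by (simp add: coarse_def spline_def p_def poly_sum case_prod_unfold)
      show "u \<in> closure {x m l..<x m (l + 1)}" using u by simp
    qed
    then show ?thesis by simp
  qed
  ultimately show ?thesis by blast
qed

lemma coarse_poly': "\<exists>p. degree p \<le> k - 1 \<and> (\<forall>u\<in>{x m i..x m (i + 1)}. coarse m u = poly p (of_real u))"
proof -
  obtain l where "x (m - 1) l \<le> x m i" "x m (i + 1) \<le> x (m - 1) (l + 1)"
    using ex_ancestor[of "m - 1" m i] by auto
  then have "{x m i..x m (i + 1)} \<subseteq> {x (m - 1) l..x (m - 1) (l + 1)}" by auto
  then show ?thesis using coarse_poly[of "m - 1" l] by auto
qed

text \<open>Where \<open>g\<close> and its coarse part differ, some fine B-spline is nonzero. Its
  support contains \<open>u\<close>, hence meets the window and is counted.\<close>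

lemma cover_ge_1:
  assumes u: "u \<in> {window_left m j..window_right m j}" and ne: "g u \<noteq> coarse m u"
  shows "cover m j u \<ge> 1"
proof -
  let ?F = "{Q \<in> \<Lambda>. fst Q < m}" and ?G = "{Q \<in> \<Lambda>. m \<le> fst Q}"
  have "\<Lambda> = ?F \<union> ?G" by auto
  then have "g u = spline x (k - 1) (?F \<union> ?G) coef u" unfolding g_def by (rule arg_cong)
  also have "\<dots> = coarse m u + spline x (k - 1) ?G coef u"
    unfolding coarse_def using fin by (intro spline_union) auto
  finally have "g u = coarse m u + spline x (k - 1) ?G coef u" .
  with ne have "spline x (k - 1) ?G coef u \<noteq> 0" by auto
  then have "\<exists>m' i. (m', i) \<in> ?G \<and> u \<in> {x m' i..x m' (i + int (k - 1) + 1)}"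
    using spline_eq_0[of x ?G u "k - 1" coef, OF strict_mono_nodes] by blast
  then obtain m' i where Q: "(m', i) \<in> \<Lambda>" "m \<le> m'" "u \<in> {x m' i..x m' (i + int (k - 1) + 1)}"
    by auto
  have s: "i + int (k - 1) + 1 = i + int k" using k by simp
  have "(m', i) \<in> finer m j" using Q u k unfolding s by (auto simp: finer_def meets_def window_left_def window_right_def)
  then have "indicator {x (fst (m', i)) (snd (m', i))..x (fst (m', i)) (snd (m', i) + int k)} u \<le> cover m j u"
    unfolding cover_def by (intro member_le_sum finite_finer) auto
  then show ?thesis using Q unfolding s by simp
qed

lemma cover_nonneg: "cover m j u \<ge> 0"
  unfolding cover_def by (intro sum_nonneg) auto

text \<open>A support of level \<open>m + s\<close> has length at most
  \<open>k * lam * \<rho> ^ s\<close> cell lengths; summing over \<open>finer\<close> produces the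
  weight.\<close>

lemma cover_integral:
  shows "cover m j integrable_on {c..d}"
    and "integral {c..d} (cover m j) \<le> real k * lam * fine_weight m j * cell_length m i"
proof -
  have i: "(indicator {x (fst Q) (snd Q)..x (fst Q) (snd Q + int k)} :: real \<Rightarrow> real) integrable_on {c..d}" for Q
    by (intro integral_indicator_Icc_le) simp
  show "cover m j integrable_on {c..d}"
    unfolding cover_def[abs_def] by (intro integrable_sum finite_finer i)
  have "integral {c..d} (cover m j) =
      (\<Sum>Q\<in>finer m j. integral {c..d} (indicator {x (fst Q) (snd Q)..x (fst Q) (snd Q + int k)}))"
    unfolding cover_def[abs_def] by (intro integral_sum finite_finer i)
  also have "\<dots> \<le> (\<Sum>Q\<in>finer m j. real k * (lam * \<rho> ^ nat (fst Q - m) * cell_length m i))"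
  proof (rule sum_mono)
    fix Q assume "Q \<in> finer m j"
    then have Q: "m + int (nat (fst Q - m)) = fst Q" by (simp add: finer_def)
    have "integral {c..d} (indicator {x (fst Q) (snd Q)..x (fst Q) (snd Q + int k)} :: real \<Rightarrow> real) \<le>
        x (fst Q) (snd Q + int k) - x (fst Q) (snd Q)"
      by (intro integral_indicator_Icc_le) simp
    also have "\<dots> \<le> real k * (lam * \<rho> ^ nat (fst Q - m) * cell_length m i)"
      using length_r_le[of m "nat (fst Q - m)" "snd Q" k i] unfolding Q cell_length_def .
    finally show "integral {c..d} (indicator {x (fst Q) (snd Q)..x (fst Q) (snd Q + int k)} :: real \<Rightarrow> real) \<le>
      real k * (lam * \<rho> ^ nat (fst Q - m) * cell_length m i)" .
  qed
  also have "\<dots> = real k * lam * fine_weight m j * cell_length m i"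
    by (simp add: fine_weight_def sum_distrib_left sum_distrib_right mult_ac)
  finally show "integral {c..d} (cover m j) \<le> real k * lam * fine_weight m j * cell_length m i" .
qed

text \<open>Otherwise each point of the subinterval is covered by a fine support or has a large
  deviation of \<open>g\<close> from its mean. By Chebyshev's inequality each alternative takes up
  at most a third of the length.\<close>

lemma ex_sample_point:
  assumes good: "fine_weight m j < threshold" and cd: "window_left m j \<le> c" "d \<le> window_right m j" "d - c = cell_length m i / (2 * real k)"
  shows "\<exists>y\<in>{c..d}. coarse m y = g y \<and>
    norm (g y - avg (window_left m j) (window_right m j) g) \<le> 12 * real k ^ 2 * lam * B"
proof (rule ccontr)
  let ?v = "avg (window_left m j) (window_right m j) g"
  define M where "M = 12 * real k ^ 2 * lam * B"
  have M: "M > 0" using k lam B by (simp add: M_def)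
  have L: "cell_length m i > 0" by (rule cell_length_pos)
  have l: "d - c > 0" using cd(3) L k by simp
  assume "\<not> ?thesis"
  then have *: "coarse m y = g y \<Longrightarrow> norm (g y - ?v) > M" if "y \<in> {c..d}" for y
    using that by (auto simp: M_def not_le)
  have pt: "1 \<le> cover m j y + norm (g y - ?v) / M" if y: "y \<in> {c..d}" for y
  proof (cases "coarse m y = g y")
    case True
    then have "norm (g y - ?v) / M \<ge> 1" using *[OF y] M by simp
    then show ?thesis using cover_nonneg[of m j y] by simp
  next
    case False
    then have "cover m j y \<ge> 1" using y cd by (intro cover_ge_1) auto
    moreover have "norm (g y - ?v) / M \<ge> 0" using M by simp
    ultimately show ?thesis by linarith
  qed
  have i1: "(\<lambda>y. norm (g y - ?v) / M) integrable_on {c..d}"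
    using M by (intro integrable_continuous_real continuous_intros continuous_on_g) auto
  have "integral {c..d} (\<lambda>y. 1 :: real) \<le> integral {c..d} (\<lambda>y. cover m j y + norm (g y - ?v) / M)"
    by (intro integral_le integrable_const_ivl integrable_add cover_integral i1 pt)
  also have "\<dots> = integral {c..d} (cover m j) + integral {c..d} (\<lambda>y. norm (g y - ?v)) / M"
    by (subst Henstock_Kurzweil_Integration.integral_add[OF cover_integral(1) i1]) simp
  also have "integral {c..d} (\<lambda>y. norm (g y - ?v)) \<le> integral {window_left m j..window_right m j} (\<lambda>y. norm (g y - ?v))"
    using cd by (intro integral_subset_le integrable_continuous_real continuous_intros continuous_on_g) auto
  also have "\<dots> \<le> B * (window_right m j - window_left m j)" by (intro bmo_g window_left_less_right)
  also have "\<dots> \<le> B * (2 * real k * lam * cell_length m i)"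
    using B by (intro mult_left_mono window_length_le) auto
  also have "integral {c..d} (cover m j) \<le> real k * lam * fine_weight m j * cell_length m i" by (rule cover_integral)
  also have "\<dots> \<le> real k * lam * threshold * cell_length m i"
    using good k lam L by (intro mult_right_mono mult_left_mono) auto
  \<comment> \<open>The values of \<open>threshold\<close> and \<open>M\<close> are chosen to make
    this term and the next exactly a third.\<close>
  also have "\<dots> = (d - c) / 3"
    using k lam by (simp add: threshold_def cd(3) power2_eq_square field_simps)
  also have "B * (2 * real k * lam * cell_length m i) / M = (d - c) / 3"
    using k lam B by (simp add: M_def cd(3) power2_eq_square field_simps)
  finally show False using l M by (simp add: divide_right_mono)
qed

text \<open>On the cell the coarse part is a polynomial of degree at most \<open>k - 1\<close>, and
  it is close to the mean of \<open>g\<close> at \<open>k\<close> separated sample points. The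
  polynomial bounds apply to its difference from that mean.\<close>

lemma coarse_bounds:
  assumes good: "fine_weight m j < threshold" and i: "j + 1 - int k \<le> i" "i < j + int k"
  shows "\<forall>u\<in>{x m i..x m (i + 1)}. norm (coarse m u - avg (window_left m j) (window_right m j) g) \<le> sup_const * B"
    and "\<forall>u\<in>{x m i..x m (i + 1)}. \<forall>v\<in>{x m i..x m (i + 1)}.
      norm (coarse m u - coarse m v) \<le> sup_const * B * \<bar>u - v\<bar> / cell_length m i"
proof -
  let ?v = "avg (window_left m j) (window_right m j) g"
  define M where "M = 12 * real k ^ 2 * lam * B"
  define l where "l = cell_length m i / (2 * real k)"
  have l: "l > 0" using cell_length_pos[of m i] k by (simp add: l_def)
  have lk: "2 * real k * l = cell_length m i" using k by (simp add: l_def)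
  have W: "window_left m j \<le> x m i" "x m (i + 1) \<le> window_right m j" using i by (auto simp: window_left_def window_right_def)
  have step: "(2 * real n + 1) * l \<le> cell_length m i" if "n < k" for n
  proof -
    have "(2 * real n + 1) * l \<le> 2 * real k * l" using that l by (intro mult_right_mono) auto
    then show ?thesis by (simp only: lk)
  qed
  \<comment> \<open>Sample points are taken in every second one of the \<open>2 * k\<close> equal
    pieces; the skipped pieces keep them at distance \<open>l\<close>.\<close>
  have "\<forall>n\<in>{..<k}. \<exists>y. y \<in> {x m i + 2 * real n * l..x m i + (2 * real n + 1) * l} \<and>
      coarse m y = g y \<and> norm (g y - ?v) \<le> M"
    unfolding M_def Bex_def[symmetric]
  proof (intro ballI ex_sample_point[OF good, of _ _ i])
    fix n assume "n \<in> {..<k}"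
    then have that: "n < k" by simp
    show "window_left m j \<le> x m i + 2 * real n * l" using W l by (intro add_increasing2) auto
    show "x m i + (2 * real n + 1) * l \<le> window_right m j" using step[OF that] W by (simp add: cell_length_def)
    show "x m i + (2 * real n + 1) * l - (x m i + 2 * real n * l) = cell_length m i / (2 * real k)"
      unfolding l_def[symmetric] by (simp add: algebra_simps)
  qed
  from bchoice[OF this] obtain y where y: "\<And>n. n < k \<Longrightarrow> y n \<in> {x m i + 2 * real n * l..x m i + (2 * real n + 1) * l}"
    "\<And>n. n < k \<Longrightarrow> coarse m (y n) = g (y n)" "\<And>n. n < k \<Longrightarrow> norm (g (y n) - ?v) \<le> M"
    by blast
  have sep: "l \<le> y n' - y n" if "n < n'" "n' < k" for n n'
  proof -
    have "(2 * real n + 2) * l \<le> 2 * real n' * l" using that l by (intro mult_right_mono) auto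
    moreover have "y n \<le> x m i + (2 * real n + 1) * l" "x m i + 2 * real n' * l \<le> y n'"
      using y(1)[of n] y(1)[of n'] that by auto
    ultimately show ?thesis by (simp add: algebra_simps)
  qed
  have sep': "l \<le> \<bar>y n - y n'\<bar>" if "n < k" "n' < k" "n \<noteq> n'" for n n'
    using that sep[of n n'] sep[of n' n] l by (cases "n < n'") auto
  have inj: "inj_on y {..<k}" using sep' l by (force simp: inj_on_def)
  obtain p where p: "degree p \<le> k - 1" "\<And>u. u \<in> {x m i..x m (i + 1)} \<Longrightarrow> coarse m u = poly p (of_real u)"
    using coarse_poly' by blast
  let ?p = "p - [:?v:]"
  have yi: "y n \<in> {x m i..x m (i + 1)}" if "n < k" for n
  proof -
    have "0 \<le> 2 * real n * l" using l by simp
    with y(1)[OF that] step[OF that] show ?thesis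
      unfolding cell_length_def atLeastAtMost_iff by linarith
  qed
  have *: "(\<forall>u\<in>{x m i..x m (i + 1)}. norm (poly ?p (of_real u)) \<le> markov_const k * M) \<and>
      (\<forall>u\<in>{x m i..x m (i + 1)}. \<forall>v\<in>{x m i..x m (i + 1)}.
         norm (poly ?p (of_real u) - poly ?p (of_real v)) \<le>
           markov_const k * M * \<bar>u - v\<bar> / (x m (i + 1) - x m i))"
  proof (rule markov_const(2)[OF k1(1), where Y = "y ` {..<k}"])
    show "degree ?p \<le> k - 1" using p(1) by (intro degree_diff_le) auto
    show "card (y ` {..<k}) = k" by (simp add: card_image inj)
    show "\<forall>z\<in>y ` {..<k}. \<forall>z'\<in>y ` {..<k}. z \<noteq> z' \<longrightarrow>
        1 / (2 * real k) * (x m (i + 1) - x m i) \<le> \<bar>z - z'\<bar>"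
      using sep' by (auto simp: l_def cell_length_def)
    show "\<forall>z\<in>y ` {..<k}. norm (poly ?p (of_real z)) \<le> M"
      using y(2,3) p(2)[OF yi] by auto
  qed (use yi in auto)
  have MM: "markov_const k * M = sup_const * B" by (simp add: sup_const_def M_def)
  show "\<forall>u\<in>{x m i..x m (i + 1)}. norm (coarse m u - ?v) \<le> sup_const * B"
    using conjunct1[OF *] p(2) unfolding MM by auto
  show "\<forall>u\<in>{x m i..x m (i + 1)}. \<forall>v\<in>{x m i..x m (i + 1)}.
      norm (coarse m u - coarse m v) \<le> sup_const * B * \<bar>u - v\<bar> / cell_length m i"
    using conjunct2[OF *] p(2) unfolding MM cell_length_def by auto
qed

lemma coarse_bound_window:
  assumes good: "fine_weight m j < threshold" and u: "u \<in> {window_left m j..window_right m j}"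
  shows "norm (coarse m u - avg (window_left m j) (window_right m j) g) \<le> sup_const * B"
proof -
  obtain l where l: "x m l \<le> u" "u < x m (l + 1)" using ex_interval by blast
  have "x m (j + 1 - int k) < x m (l + 1)" using l u unfolding window_left_def atLeastAtMost_iff by linarith
  then have l1: "j + 1 - int k \<le> l" by simp
  show ?thesis
  proof (cases "l < j + int k")
    case True
    then show ?thesis using coarse_bounds(1)[OF good l1] l by auto
  next
    case False
    \<comment> \<open>At the right end of the window the half-open cell already lies outside, and
      the last cell of the window is used instead.\<close>
    then have "x m (j + int k) \<le> x m l" by simp
    then have "x m (j + int k) \<le> u" using l by linarith
    then have "u = x m (j + int k - 1 + 1)" using u by (simp add: window_right_def)
    then show ?thesis using coarse_bounds(1)[OF good, of "j + int k - 1"] k by auto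
  qed
qed

text \<open>The bounds on the \<open>2 * k - 1\<close> cells of the window are glued from left to
  right; \<open>lam\<close> replaces the length of each cell by that of cell
  \<open>j\<close>.\<close>

lemma coarse_lipschitz_window:
  assumes good: "fine_weight m j < threshold" and uv: "u \<in> {window_left m j..window_right m j}" "v \<in> {window_left m j..window_right m j}"
  shows "norm (coarse m u - coarse m v) \<le> sup_const * B * lam / cell_length m j * \<bar>u - v\<bar>"
proof -
  let ?K = "sup_const * B * lam / cell_length m j"
  have *: "norm (coarse m u - coarse m v) \<le> ?K * \<bar>u - v\<bar>"
    if "u \<in> {window_left m j..x m (j + 1 - int k + int r)}" "v \<in> {window_left m j..x m (j + 1 - int k + int r)}"
      "r \<le> 2 * k - 1" for r u v
    using that
  proof (induction r arbitrary: u v)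
    case 0
    then show ?case by (simp add: window_left_def)
  next
    case (Suc r)
    let ?i = "j + 1 - int k + int r"
    have e: "j + 1 - int k + int (Suc r) = ?i + 1" by simp
    show ?case
    proof (rule norm_diff_le_concat[of "window_left m j" "x m ?i" _ _ "x m (?i + 1)"])
      show "norm (coarse m u - coarse m v) \<le> ?K * \<bar>u - v\<bar>"
        if "u \<in> {window_left m j..x m ?i}" "v \<in> {window_left m j..x m ?i}" for u v
        using that Suc.prems(3) by (intro Suc.IH) auto
      show "norm (coarse m u - coarse m v) \<le> ?K * \<bar>u - v\<bar>"
        if "u \<in> {x m ?i..x m (?i + 1)}" "v \<in> {x m ?i..x m (?i + 1)}" for u v
      proof -
        have "norm (coarse m u - coarse m v) \<le> sup_const * B * \<bar>u - v\<bar> / cell_length m ?i"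
          using Suc.prems(3) k by (intro coarse_bounds(2)[OF good, rule_format] that) auto
        also have "\<dots> = (sup_const * B * \<bar>u - v\<bar>) * (1 / cell_length m ?i)" by simp
        also have "\<dots> \<le> (sup_const * B * \<bar>u - v\<bar>) * (lam / cell_length m j)"
        proof (rule mult_left_mono)
          have "cell_length m j \<le> lam * cell_length m ?i" unfolding cell_length_def by (rule length_le)
          then show "1 / cell_length m ?i \<le> lam / cell_length m j"
            using cell_length_pos[of m j] cell_length_pos[of m ?i] by (simp add: field_simps)
          show "0 \<le> sup_const * B * \<bar>u - v\<bar>" using sup_const B by simp
        qed
        finally show ?thesis by (simp add: mult_ac)
      qed
      show "window_left m j \<le> x m ?i" "x m ?i \<le> x m (?i + 1)" by (simp_all add: window_left_def)
      show "u \<in> {window_left m j..x m (?i + 1)}" "v \<in> {window_left m j..x m (?i + 1)}"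
        using Suc.prems(1,2) unfolding e .
    qed
  qed
  have e: "j + 1 - int k + int (2 * k - 1) = j + int k" using k by auto
  show ?thesis using *[of u "2 * k - 1" v, unfolded e, folded window_right_def, OF uv] by blast
qed

definition fine_const :: real where
  "fine_const = real k * lam + 2 powr (2 * q) * (2 * real k * lam) * (jn_const (2 * q) + sup_const powr (2 * q))"

lemma jn_const_nonneg: "jn_const r \<ge> 0" by (simp add: jn_const_def)

lemma fine_const: "fine_const \<ge> 0" using lam jn_const_nonneg[of "2 * q"] by (simp add: fine_const_def)

text \<open>In effect Cauchy--Schwarz: the fine part vanishes off a set of measure proportional to
  the weight, and its moment of order \<open>2 * q\<close> is controlled by John--Nirenberg and the
  bound for the coarse part. This gives the square root of the weight.\<close>

lemma integral_fine_part_le: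
  assumes good: "fine_weight m j < threshold"
  shows "integral {window_left m j..window_right m j} (\<lambda>u. norm (g u - coarse m u) powr q) \<le>
    fine_const * fine_weight m j powr (1 / 2) * B powr q * cell_length m j"
proof (cases "fine_weight m j = 0")
  case True
  have "finer m j = {}"
  proof (rule ccontr)
    assume "finer m j \<noteq> {}"
    then have "fine_weight m j > 0" unfolding fine_weight_def using \<rho> by (intro sum_pos finite_finer) auto
    with True show False by simp
  qed
  then have "g u = coarse m u" if "u \<in> {window_left m j..window_right m j}" for u
    using cover_ge_1[OF that] by (auto simp: cover_def)
  then have "integral {window_left m j..window_right m j} (\<lambda>u. norm (g u - coarse m u) powr q) =
      integral {window_left m j..window_right m j} (\<lambda>u. 0)"
    using q by (intro integral_cong) auto
  then show ?thesis using True by simp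
next
  case False
  let ?v = "avg (window_left m j) (window_right m j) g"
  let ?W = "{window_left m j..window_right m j}"
  define s where "s = fine_weight m j powr (1 / 2)"
  have D0: "fine_weight m j > 0" using False fine_weight_nonneg[of m j] by simp
  have s: "s > 0" using D0 by (simp add: s_def)
  have ss: "fine_weight m j = s * s" using D0 by (simp add: s_def flip: powr_add)
  define b where "b = B powr q"
  have b: "b > 0" using B by (simp add: b_def)
  have bb: "B powr (2 * q) = b * b" by (simp add: b_def flip: powr_add)
  define h where "h u = norm (g u - ?v) powr (2 * q)" for u
  define c where "c = (sup_const * B) powr (2 * q)"
  have q2: "2 * q > 0" using q by simp
  have ih: "h integrable_on ?W"
    unfolding h_def by (intro integrable_continuous_real continuous_on_norm_diff_powr continuous_on_g q2 continuous_intros)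
  have pt: "norm (g u - coarse m u) powr q \<le>
      b / s * cover m j u + s / b * (2 powr (2 * q) * (h u + c))" if u: "u \<in> ?W" for u
  proof (cases "g u = coarse m u")
    case True
    have "0 \<le> b / s * cover m j u" using b s cover_nonneg[of m j u] by simp
    moreover have "0 \<le> s / b * (2 powr (2 * q) * (h u + c))" using b s by (simp add: h_def c_def)
    ultimately show ?thesis using True q by simp
  next
    case False
    define w where "w = norm (g u - coarse m u) powr q"
    have w: "w \<ge> 0" by (simp add: w_def)
    have "norm (g u - coarse m u) \<le> norm (g u - ?v) + norm (coarse m u - ?v)"
      using norm_triangle_ineq4[of "g u - ?v" "coarse m u - ?v"] by simp
    also have "\<dots> \<le> norm (g u - ?v) + sup_const * B"
      using coarse_bound_window[OF good u] by simp
    finally have "norm (g u - coarse m u) powr (2 * q) \<le> (norm (g u - ?v) + sup_const * B) powr (2 * q)"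
      using q2 by (intro powr_mono2) auto
    also have "\<dots> \<le> 2 powr (2 * q) * (h u + c)"
      unfolding h_def c_def using q2 sup_const B by (intro powr_add_le) auto
    finally have ww: "w * w \<le> 2 powr (2 * q) * (h u + c)"
      by (simp add: w_def flip: powr_add)
    \<comment> \<open>Either the first summand alone suffices, or \<open>w\<close> exceeds
      \<open>b / s\<close> and the second does. The choice of \<open>s\<close> and \<open>b\<close>
      balances the two integrals.\<close>
    have "w \<le> b / s * 1 + s / b * (w * w)"
    proof (cases "w \<le> b / s")
      case True
      then show ?thesis using s b w by (simp add: add_increasing2)
    next
      case False
      then have "1 \<le> s / b * w" using s b by (simp add: field_simps)
      then have "1 * w \<le> s / b * w * w" using w by (intro mult_right_mono) auto
      then show ?thesis using s b by (simp add: mult.assoc add_increasing)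
    qed
    also have "\<dots> \<le> b / s * cover m j u + s / b * (2 powr (2 * q) * (h u + c))"
      using cover_ge_1[OF u False] ww s b by (intro add_mono mult_left_mono) auto
    finally show ?thesis by (simp add: w_def)
  qed
  have i1: "(\<lambda>u. b / s * cover m j u) integrable_on ?W"
    by (intro integrable_on_mult_right cover_integral)
  have i2: "(\<lambda>u. h u + c) integrable_on ?W"
    by (intro integrable_add ih integrable_const_ivl)
  then have i3: "(\<lambda>u. s / b * (2 powr (2 * q) * (h u + c))) integrable_on ?W"
    by (intro integrable_on_mult_right)
  have "integral ?W (\<lambda>u. norm (g u - coarse m u) powr q) \<le>
      integral ?W (\<lambda>u. b / s * cover m j u + s / b * (2 powr (2 * q) * (h u + c)))"
    by (intro integral_le integrable_add i1 i3 pt integrable_continuous_real continuous_on_norm_diff_powr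
        continuous_on_g continuous_on_coarse q)
  also have "\<dots> = b / s * integral ?W (cover m j) + s / b * (2 powr (2 * q) * integral ?W (\<lambda>u. h u + c))"
    by (subst Henstock_Kurzweil_Integration.integral_add[OF i1 i3]) simp
  also have "integral ?W (\<lambda>u. h u + c) = integral ?W h + c * (window_right m j - window_left m j)"
    using window_left_less_right[of m j]
    by (subst Henstock_Kurzweil_Integration.integral_add[OF ih integrable_const_ivl]) simp
  also have "b / s * integral ?W (cover m j) +
      s / b * (2 powr (2 * q) * (integral ?W h + c * (window_right m j - window_left m j))) \<le>
      b / s * (real k * lam * fine_weight m j * cell_length m j) + s / b * (2 powr (2 * q) *
        (jn_const (2 * q) * B powr (2 * q) * (window_right m j - window_left m j) + c * (window_right m j - window_left m j)))"
    using s b unfolding h_def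
    by (intro add_mono mult_left_mono cover_integral jn_g q2 window_left_less_right order_refl) auto
  also have "\<dots> = b * s * (real k * lam) * cell_length m j +
      s * b * 2 powr (2 * q) * (jn_const (2 * q) + sup_const powr (2 * q)) * (window_right m j - window_left m j)"
  proof -
    have c: "c = sup_const powr (2 * q) * (b * b)" using sup_const B by (simp add: c_def powr_mult bb)
    have 1: "s / b * (P * (J * (b * b) * X + K * (b * b) * X)) = s * b * P * (J + K) * X" for P J K X
      using b by (simp add: field_simps)
    have 2: "b / s * (K * (s * s) * X) = b * s * K * X" for K X
      using s by simp
    show ?thesis unfolding ss bb c 1 2 ..
  qed
  also have "\<dots> \<le> b * s * (real k * lam) * cell_length m j +
      s * b * 2 powr (2 * q) * (jn_const (2 * q) + sup_const powr (2 * q)) * (2 * real k * lam * cell_length m j)"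
    using s b jn_const_nonneg[of "2 * q"] by (intro add_left_mono mult_left_mono window_length_le) auto
  also have "\<dots> = fine_const * s * b * cell_length m j"
    by (simp add: fine_const_def algebra_simps)
  finally show ?thesis by (simp add: s_def b_def)
qed

end

section \<open>Bounds for single terms\<close>

lemma powr_sum_le:
  fixes f :: "'a \<Rightarrow> real"
  assumes "finite A" "\<And>a. a \<in> A \<Longrightarrow> f a \<ge> 0" and c: "0 < c" "c \<le> 1"
  shows "(\<Sum>a\<in>A. f a) powr c \<le> (\<Sum>a\<in>A. f a powr c)"
  using assms(1,2)
proof (induction A rule: finite_induct)
  case (insert a A)
  have two: "(u + v) powr c \<le> u powr c + v powr c" if uv: "u \<ge> 0" "v \<ge> 0" for u v :: real
  proof (cases "u + v = 0")
    case False
    then have p: "u + v > 0" using uv by auto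
    \<comment> \<open>After division by \<open>u + v\<close> the terms lie between 0 and 1, where
      lowering the exponent increases a power.\<close>
    have *: "w / (u + v) \<le> (w / (u + v)) powr c" if "w \<ge> 0" "w \<le> u + v" for w
      using powr_mono'[of c 1 "w / (u + v)"] that p c by simp
    have "1 = u / (u + v) + v / (u + v)" using p by (simp flip: add_divide_distrib)
    also have "\<dots> \<le> (u / (u + v)) powr c + (v / (u + v)) powr c"
      using uv by (intro add_mono *) auto
    also have "\<dots> = (u powr c + v powr c) / (u + v) powr c"
      using uv p by (simp add: powr_divide add_divide_distrib)
    finally show ?thesis using p by (simp add: field_simps)
  qed (use uv in auto)
  have "(\<Sum>a\<in>insert a A. f a) powr c = (f a + (\<Sum>a\<in>A. f a)) powr c"
    using insert.hyps by simp
  also have "\<dots> \<le> f a powr c + (\<Sum>a\<in>A. f a) powr c"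
    using insert.prems by (intro two sum_nonneg) auto
  also have "\<dots> \<le> f a powr c + (\<Sum>a\<in>A. f a powr c)"
    using insert by auto
  finally show ?case using insert.hyps by simp
qed simp

lemma sum_power_lessThan_le:
  fixes r :: real
  assumes "0 \<le> r" "r < 1"
  shows "(\<Sum>i<n. r ^ i) \<le> 1 / (1 - r)"
proof -
  have "(\<Sum>i<n. r ^ i) = (1 - r ^ n) / (1 - r)"
    using assms by (simp add: sum_gp_strict)
  also have "\<dots> \<le> 1 / (1 - r)" using assms by (intro divide_right_mono) auto
  finally show ?thesis .
qed

text \<open>Each pair of exponents occurs at most \<open>N\<close> times, so the sum is at most
  \<open>N\<close> times a product of two geometric series.\<close>

lemma sum_geometric_fibers_le:
  fixes key :: "'a \<Rightarrow> nat \<times> nat" and r s :: real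
  assumes J: "finite J" and r: "0 \<le> r" "r < 1" and s: "0 \<le> s" "s < 1"
    and N: "\<And>t u. card {z \<in> J. key z = (t, u)} \<le> N"
  shows "(\<Sum>z\<in>J. r ^ fst (key z) * s ^ snd (key z)) \<le> real N / ((1 - r) * (1 - s))"
proof -
  define n where "n = Suc (Max (insert 0 (fst ` key ` J \<union> snd ` key ` J)))"
  have sub: "key ` J \<subseteq> {..<n} \<times> {..<n}"
  proof
    fix y assume y: "y \<in> key ` J"
    have "w \<in> insert 0 (fst ` key ` J \<union> snd ` key ` J) \<Longrightarrow> w < n" for w
      unfolding n_def using J by (intro le_imp_less_Suc Max_ge) auto
    then have "fst y < n" "snd y < n" using y by auto
    then show "y \<in> {..<n} \<times> {..<n}" by (simp add: mem_Times_iff)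
  qed
  have "(\<Sum>z\<in>J. r ^ fst (key z) * s ^ snd (key z)) =
      (\<Sum>y\<in>key ` J. \<Sum>z | z \<in> J \<and> key z = y. r ^ fst (key z) * s ^ snd (key z))"
    by (rule sum.image_gen[OF J])
  also have "\<dots> = (\<Sum>y\<in>key ` J. real (card {z \<in> J. key z = y}) * (r ^ fst y * s ^ snd y))"
    by (intro sum.cong) auto
  also have "\<dots> \<le> (\<Sum>y\<in>key ` J. real N * (r ^ fst y * s ^ snd y))"
    using N r s by (intro sum_mono mult_right_mono) (auto simp: split_paired_all)
  also have "\<dots> \<le> (\<Sum>y\<in>{..<n} \<times> {..<n}. real N * (r ^ fst y * s ^ snd y))"
    using sub r s by (intro sum_mono2) auto
  also have "\<dots> = real N * ((\<Sum>i<n. r ^ i) * (\<Sum>j<n. s ^ j))"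
    unfolding sum_distrib_left[symmetric]
    by (simp only: sum_product sum.cartesian_product case_prod_unfold)
  also have "\<dots> \<le> real N * (1 / (1 - r) * (1 / (1 - s)))"
    using r s by (intro mult_left_mono mult_mono sum_power_lessThan_le sum_nonneg) auto
  finally show ?thesis by simp
qed

section \<open>Terms of the Besov quasi-norm\<close>

context nterm_spline
begin

definition besov_term :: "real \<Rightarrow> int \<Rightarrow> int \<Rightarrow> ennreal" where
  "besov_term \<tau> m j = ennreal_powr (ennreal ((x m (j + 1) - x m j) powr (- 1 / q)) *
     modulus_smoothness k q g {x m (j + 1 - int k)..x m (j + int k)}) \<tau>"

lemma besov_term_le':
  assumes "degree p < k" "\<tau> \<ge> 0"
    and "integral {window_left m j..window_right m j} (\<lambda>u. norm (g u - poly p (of_real u)) powr q) \<le> K * cell_length m j"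
  shows "besov_term \<tau> m j \<le> ennreal ((diff_const k q * K) powr (\<tau> / q))"
proof -
  let ?I = "integral {window_left m j..window_right m j} (\<lambda>u. norm (g u - poly p (of_real u)) powr q)"
  have "?I \<ge> 0"
    by (intro integral_nonneg integrable_continuous_real continuous_on_norm_diff_powr continuous_on_g q continuous_intros) auto
  moreover have "?I / cell_length m j \<le> K" using assms(3) cell_length_pos[of m j] by (simp add: field_simps)
  moreover have "diff_const k q \<ge> 0" by (simp add: diff_const_def)
  ultimately have "(diff_const k q * (?I / cell_length m j)) powr (\<tau> / q) \<le> (diff_const k q * K) powr (\<tau> / q)"
    using assms(2) q cell_length_pos[of m j] by (intro powr_mono2 mult_left_mono mult_nonneg_nonneg) auto
  then show ?thesis
    using besov_term_le[OF continuous_on_g q assms(1) cell_length_pos assms(2), of m j "window_left m j" "window_right m j"]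
    unfolding besov_term_def window_left_def window_right_def cell_length_def by (meson ennreal_leI order_trans)
qed

definition trivial_const :: "real \<Rightarrow> real" where
  "trivial_const \<tau> = (diff_const k q * (jn_const q * (2 * real k * lam))) powr (\<tau> / q)"

text \<open>Approximate \<open>g\<close> by its mean over the window and apply the John--Nirenberg
  inequality with exponent \<open>q\<close>.\<close>

lemma besov_term_le_trivial:
  assumes "\<tau> > 0"
  shows "besov_term \<tau> m j \<le> ennreal (trivial_const \<tau> * B powr \<tau>)"
proof -
  let ?v = "avg (window_left m j) (window_right m j) g"
  have "besov_term \<tau> m j \<le> ennreal ((diff_const k q * (jn_const q * (2 * real k * lam) * B powr q)) powr (\<tau> / q))"
  proof (rule besov_term_le'[of "[:?v:]"])
    have "integral {window_left m j..window_right m j} (\<lambda>u. norm (g u - ?v) powr q) \<le> jn_const q * B powr q * (window_right m j - window_left m j)"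
      by (intro jn_g q window_left_less_right)
    also have "\<dots> \<le> jn_const q * B powr q * (2 * real k * lam * cell_length m j)"
      using jn_const_nonneg[of q] by (intro mult_left_mono window_length_le) auto
    finally show "integral {window_left m j..window_right m j} (\<lambda>u. norm (g u - poly [:?v:] (of_real u)) powr q) \<le>
        jn_const q * (2 * real k * lam) * B powr q * cell_length m j"
      by (simp add: mult_ac)
  qed (use k assms in auto)
  also have "(diff_const k q * (jn_const q * (2 * real k * lam) * B powr q)) powr (\<tau> / q) = trivial_const \<tau> * B powr \<tau>"
  proof -
    have "(diff_const k q * (jn_const q * (2 * real k * lam) * B powr q)) powr (\<tau> / q) =
        (diff_const k q * (jn_const q * (2 * real k * lam)) * B powr q) powr (\<tau> / q)"
      by (simp only: mult.assoc)
    also have "\<dots> = trivial_const \<tau> * (B powr q) powr (\<tau> / q)"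
      unfolding trivial_const_def by (rule powr_mult)
    finally show ?thesis using q by (simp add: powr_powr)
  qed
  finally show ?thesis .
qed

definition good_const :: "real \<Rightarrow> real" where
  "good_const \<tau> = (diff_const k q * (2 powr q * (fine_const + 2 * real k * lam))) powr (\<tau> / q) * 2 powr (\<tau> / q)"

text \<open>Split \<open>g - p\<close> at the coarse part. The first piece is bounded by
  \<open>integral_fine_part_le\<close>, whose square root turns into the exponent
  \<open>\<tau> / (2 * q)\<close>; the second is at most \<open>\<epsilon> * B\<close>.\<close>

lemma besov_term_le_good:
  assumes \<tau>: "\<tau> > 0" and good: "fine_weight m j < threshold" and p: "degree p < k" and \<epsilon>: "\<epsilon> \<ge> 0"
    and le: "\<And>u. u \<in> {window_left m j..window_right m j} \<Longrightarrow> norm (coarse m u - poly p (of_real u)) \<le> \<epsilon> * B"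
  shows "besov_term \<tau> m j \<le> ennreal (good_const \<tau> * B powr \<tau> * (fine_weight m j powr (\<tau> / (2 * q)) + \<epsilon> powr \<tau>))"
proof -
  let ?W = "{window_left m j..window_right m j}"
  define s where "s = fine_weight m j powr (1 / 2)"
  have s: "s \<ge> 0" by (simp add: s_def)
  define K where "K = 2 powr q * (fine_const + 2 * real k * lam) * B powr q * (s + \<epsilon> powr q)"
  have lam0: "2 * real k * lam \<ge> 0" using lam by simp
  have dc: "diff_const k q \<ge> 0" by (simp add: diff_const_def)
  have ci: "(\<lambda>u. norm (g u - coarse m u) powr q) integrable_on ?W"
    by (intro integrable_continuous_real continuous_on_norm_diff_powr continuous_on_g continuous_on_coarse q)
  have "besov_term \<tau> m j \<le> ennreal ((diff_const k q * K) powr (\<tau> / q))"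
  proof (rule besov_term_le'[OF p])
    have "norm (g u - poly p (of_real u)) powr q \<le>
        2 powr q * (norm (g u - coarse m u) powr q + (\<epsilon> * B) powr q)" if u: "u \<in> ?W" for u
    proof -
      have "norm (g u - poly p (of_real u)) \<le> norm (g u - coarse m u) + \<epsilon> * B"
        using le[OF u] norm_triangle_ineq[of "g u - coarse m u" "coarse m u - poly p (of_real u)"] by simp
      then have "norm (g u - poly p (of_real u)) powr q \<le> (norm (g u - coarse m u) + \<epsilon> * B) powr q"
        using q by (intro powr_mono2) auto
      also have "\<dots> \<le> 2 powr q * (norm (g u - coarse m u) powr q + (\<epsilon> * B) powr q)"
        using \<epsilon> B q by (intro powr_add_le) auto
      finally show ?thesis .
    qed
    then have "integral ?W (\<lambda>u. norm (g u - poly p (of_real u)) powr q) \<le>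
        integral ?W (\<lambda>u. 2 powr q * (norm (g u - coarse m u) powr q + (\<epsilon> * B) powr q))"
      by (intro integral_le integrable_on_mult_right integrable_add ci integrable_const_ivl
          integrable_continuous_real continuous_on_norm_diff_powr continuous_on_g q continuous_intros)
    also have "\<dots> = 2 powr q * (integral ?W (\<lambda>u. norm (g u - coarse m u) powr q) + (\<epsilon> * B) powr q * (window_right m j - window_left m j))"
      using Henstock_Kurzweil_Integration.integral_add[OF ci integrable_const_ivl] window_left_less_right[of m j] by simp
    also have "\<dots> \<le> 2 powr q * (fine_const * s * B powr q * cell_length m j + (\<epsilon> * B) powr q * (2 * real k * lam * cell_length m j))"
      unfolding s_def
      by (intro mult_left_mono add_mono integral_fine_part_le[OF good] window_length_le) auto
    also have "(\<epsilon> * B) powr q = \<epsilon> powr q * B powr q"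
      using \<epsilon> B by (simp add: powr_mult)
    also have "2 powr q * (fine_const * s * B powr q * cell_length m j + \<epsilon> powr q * B powr q * (2 * real k * lam * cell_length m j)) =
        2 powr q * B powr q * cell_length m j * (fine_const * s + 2 * real k * lam * \<epsilon> powr q)"
      by (simp add: algebra_simps)
    also have "\<dots> \<le> 2 powr q * B powr q * cell_length m j * ((fine_const + 2 * real k * lam) * (s + \<epsilon> powr q))"
    proof (rule mult_left_mono)
      have "(fine_const + 2 * real k * lam) * (s + \<epsilon> powr q) =
          fine_const * s + 2 * real k * lam * \<epsilon> powr q + (fine_const * \<epsilon> powr q + 2 * real k * lam * s)"
        by (simp add: algebra_simps)
      moreover have "fine_const * \<epsilon> powr q + 2 * real k * lam * s \<ge> 0"
        using fine_const lam s by (intro add_nonneg_nonneg mult_nonneg_nonneg) auto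
      ultimately show "fine_const * s + 2 * real k * lam * \<epsilon> powr q \<le> (fine_const + 2 * real k * lam) * (s + \<epsilon> powr q)"
        by linarith
    qed (use cell_length_pos[of m j] in auto)
    also have "\<dots> = K * cell_length m j" by (simp add: K_def)
    finally show "integral ?W (\<lambda>u. norm (g u - poly p (of_real u)) powr q) \<le> K * cell_length m j" .
  qed (use \<tau> in auto)
  also have "(diff_const k q * K) powr (\<tau> / q) =
      (diff_const k q * (2 powr q * (fine_const + 2 * real k * lam))) powr (\<tau> / q) *
        (B powr q) powr (\<tau> / q) * (s + \<epsilon> powr q) powr (\<tau> / q)"
  proof -
    have "diff_const k q * K = diff_const k q * (2 powr q * (fine_const + 2 * real k * lam)) * B powr q * (s + \<epsilon> powr q)"
      by (simp add: K_def)
    then show ?thesis using dc fine_const lam0 s by (simp only: powr_mult)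
  qed
  also have "\<dots> \<le> (diff_const k q * (2 powr q * (fine_const + 2 * real k * lam))) powr (\<tau> / q) *
        (B powr q) powr (\<tau> / q) * (2 powr (\<tau> / q) * (s powr (\<tau> / q) + (\<epsilon> powr q) powr (\<tau> / q)))"
    using s \<tau> q by (intro mult_left_mono powr_add_le) auto
  also have "\<dots> = good_const \<tau> * B powr \<tau> * (fine_weight m j powr (\<tau> / (2 * q)) + \<epsilon> powr \<tau>)"
    using q by (simp add: good_const_def s_def powr_powr)
  finally show ?thesis by (simp add: ennreal_leI)
qed

text \<open>A B-spline of an intermediate level that reaches the window also meets the larger window
  of the ancestor on its own level. There it would contribute \<open>\<rho> ^ 0 = 1\<close> to a
  weight below 1.\<close>

lemma coarse_eq_coarser:
  assumes good: "\<And>s. s \<le> t \<Longrightarrow> fine_weight (m - int s) (anc s m j) < 1" and u: "u \<in> {window_left m j..window_right m j}"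
  shows "coarse m u = coarse (m - int t) u"
proof -
  let ?F = "{Q \<in> \<Lambda>. fst Q < m - int t}" and ?G = "{Q \<in> \<Lambda>. m - int t \<le> fst Q \<and> fst Q < m}"
  have "{Q \<in> \<Lambda>. fst Q < m} = ?F \<union> ?G" by auto
  then have "coarse m u = spline x (k - 1) (?F \<union> ?G) coef u" by (simp add: coarse_def)
  also have "\<dots> = coarse (m - int t) u + spline x (k - 1) ?G coef u"
    unfolding coarse_def using fin by (intro spline_union) auto
  also have "spline x (k - 1) ?G coef u = 0"
  proof (rule spline_eq_0[OF strict_mono_nodes], rule notI)
    fix m' i assume Q: "(m', i) \<in> ?G" and ui: "u \<in> {x m' i..x m' (i + int (k - 1) + 1)}"
    define s where "s = nat (m - m')"
    have s: "s \<le> t" "m - int s = m'" using Q by (auto simp: s_def)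
    have e: "i + int (k - 1) + 1 = i + int k" using k by simp
    have "x m' (anc s m j + 1 - int k) \<le> window_left m j" "window_right m j \<le> x m' (anc s m j + int k)"
      using anc_window[OF k1(1), of 0 s m j] unfolding s window_left_def window_right_def by auto
    then have "x m' (anc s m j + 1 - int k) \<le> x m' (i + int k)" "x m' i \<le> x m' (anc s m j + int k)"
      using ui u unfolding e atLeastAtMost_iff by linarith+
    then have "(m', i) \<in> finer m' (anc s m j)"
      using Q by (simp add: finer_def meets_def)
    then have "\<rho> ^ nat (fst (m', i) - m') \<le> fine_weight m' (anc s m j)"
      unfolding fine_weight_def using \<rho> by (intro member_le_sum finite_finer) auto
    then show False using good[OF s(1)] unfolding s by simp
  qed
  finally show ?thesis by simp
qed

text \<open>The divisor \<open>\<rho>\<close> accounts for the shift between \<open>s\<close> and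
  \<open>t = s - 1\<close> in \<open>besov_term_cases\<close>.\<close>

definition osc_const :: real where "osc_const = sup_const * lam * (2 * real k * lam) / \<rho>"

lemma osc_const: "osc_const \<ge> 0" using sup_const lam \<rho> by (simp add: osc_const_def)

text \<open>The first alternative covers every case in which the coarse part is a polynomial on the
  window. In the second, \<open>s\<close> leads to the nearest bad ancestor; the node inside the
  window is recorded because it limits the number of such cells.\<close>

lemma besov_term_cases:
  assumes \<tau>: "\<tau> > 0" and good: "fine_weight m j < threshold"
  shows "besov_term \<tau> m j \<le> ennreal (good_const \<tau> * B powr \<tau> * fine_weight m j powr (\<tau> / (2 * q))) \<or>
    (\<exists>s. threshold \<le> fine_weight (m - int s) (anc s m j) \<and>
      (\<exists>l. window_left m j \<le> x (m - int s) l \<and> x (m - int s) l \<le> window_right m j) \<and>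
      besov_term \<tau> m j \<le> ennreal (good_const \<tau> * B powr \<tau> * (fine_weight m j powr (\<tau> / (2 * q)) + (osc_const * \<rho> ^ s) powr \<tau>)))"
proof -
  have poly_case: "besov_term \<tau> m j \<le> ennreal (good_const \<tau> * B powr \<tau> * fine_weight m j powr (\<tau> / (2 * q)))"
    if "degree p < k" "\<And>u. u \<in> {window_left m j..window_right m j} \<Longrightarrow> coarse m u = poly p (of_real u)" for p
    using besov_term_le_good[OF \<tau> good that(1), of 0] that(2) \<tau> by simp
  show ?thesis
  proof (cases "\<exists>s. threshold \<le> fine_weight (m - int s) (anc s m j)")
    case False
    \<comment> \<open>Without a bad ancestor one can ascend below all levels of
      \<open>\<Lambda>\<close>, where the coarse part is 0.\<close>
    obtain b where b: "\<And>Q. Q \<in> \<Lambda> \<Longrightarrow> b \<le> fst Q"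
      using bdd_below_finite[of "fst ` \<Lambda>"] fin by (auto simp: bdd_below_def)
    define t where "t = nat (m - b)"
    have "coarse m u = 0" if u: "u \<in> {window_left m j..window_right m j}" for u
    proof -
      have "coarse m u = coarse (m - int t) u"
        using False threshold u by (intro coarse_eq_coarser[of t m j]) (auto simp: not_le intro: less_le_trans)
      also have "coarse (m - int t) = spline x (k - 1) {} coef"
        unfolding coarse_def using b by (intro arg_cong[where f = "\<lambda>A. spline x (k - 1) A coef"]) (force simp: t_def)
      finally show ?thesis by (simp add: spline_def)
    qed
    then show ?thesis using poly_case[of 0] k by simp
  next
    case True
    define s where "s = (LEAST s. threshold \<le> fine_weight (m - int s) (anc s m j))"
    have bad: "threshold \<le> fine_weight (m - int s) (anc s m j)" unfolding s_def using True by (rule LeastI_ex)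
    have least: "fine_weight (m - int t) (anc t m j) < threshold" if "t < s" for t
      using not_less_Least[of t] that unfolding s_def by force
    \<comment> \<open>The cell itself is good, so \<open>s > 0\<close>, and \<open>t\<close> leads
      to the last good ancestor.\<close>
    obtain t where t: "s = Suc t" using bad good by (cases s) auto
    have eq: "coarse m u = coarse (m - int t) u" if "u \<in> {window_left m j..window_right m j}" for u
      using least threshold that t by (intro coarse_eq_coarser[of t m j]) (auto intro: less_le_trans)
    have mt: "m - int t = m - int s + 1" using t by simp
    obtain l where l: "x (m - int s) l \<le> window_left m j" "window_left m j < x (m - int s) (l + 1)" using ex_interval by blast
    show ?thesis
    proof (cases "window_right m j \<le> x (m - int s) (l + 1)")
      case True
      obtain p where p: "degree p \<le> k - 1"
        "\<And>u. u \<in> {x (m - int s) l..x (m - int s) (l + 1)} \<Longrightarrow> coarse (m - int s + 1) u = poly p (of_real u)"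
        using coarse_poly by blast
      have "coarse m u = poly p (of_real u)" if "u \<in> {window_left m j..window_right m j}" for u
        unfolding eq[OF that] mt using that l True by (intro p) auto
      moreover have "degree p < k" using p(1) k by simp
      ultimately show ?thesis using poly_case by blast
    next
      case False
      \<comment> \<open>The Lipschitz bound is taken on the larger window of the last good ancestor,
        and the small length of the present window supplies the power of
        \<open>\<rho>\<close>.\<close>
      let ?i = "anc t m j" and ?n = "m - int t"
      have W: "window_left ?n ?i \<le> window_left m j" "window_right m j \<le> window_right ?n ?i"
        using anc_window[OF k1(1), of 0 t m j] unfolding window_left_def window_right_def by auto
      have "norm (coarse m u - poly [:coarse m (window_left m j):] (of_real u)) \<le> osc_const * \<rho> ^ s * B"
        if u: "u \<in> {window_left m j..window_right m j}" for u
      proof -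
        have wlu: "window_left m j \<in> {window_left m j..window_right m j}" using window_left_less_right[of m j] by simp
        have "norm (coarse ?n u - coarse ?n (window_left m j)) \<le> sup_const * B * lam / cell_length ?n ?i * \<bar>u - window_left m j\<bar>"
          using least[of t] t u W window_left_less_right[of m j] by (intro coarse_lipschitz_window) auto
        also have "\<dots> \<le> sup_const * B * lam / cell_length ?n ?i * (window_right m j - window_left m j)"
          using u sup_const B lam cell_length_pos[of ?n ?i] by (intro mult_left_mono) auto
        also have "\<dots> \<le> sup_const * B * lam / cell_length ?n ?i * (2 * real k * (lam * \<rho> ^ t * cell_length ?n ?i))"
        proof (rule mult_left_mono)
          have e: "j + 1 - int k + int (2 * k - 1) = j + int k" "m - int t + int t = m"
            using k by auto
          have "window_right m j - window_left m j \<le> real (2 * k - 1) * (lam * \<rho> ^ t * cell_length ?n ?i)"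
            using length_r_le[of "m - int t" t "j + 1 - int k" "2 * k - 1" ?i]
            unfolding window_left_def window_right_def cell_length_def e .
          also have "\<dots> \<le> 2 * real k * (lam * \<rho> ^ t * cell_length ?n ?i)"
            using lam \<rho> cell_length_pos[of ?n ?i] by (intro mult_right_mono) auto
          finally show "window_right m j - window_left m j \<le> 2 * real k * (lam * \<rho> ^ t * cell_length ?n ?i)" .
        qed (use sup_const B lam cell_length_pos[of ?n ?i] in auto)
        also have "\<dots> = osc_const * \<rho> ^ s * B"
          using cell_length_pos[of ?n ?i] \<rho> by (simp add: osc_const_def t)
        finally show ?thesis using eq[OF u] eq[OF wlu] by simp
      qed
      then have "besov_term \<tau> m j \<le> ennreal (good_const \<tau> * B powr \<tau> * (fine_weight m j powr (\<tau> / (2 * q)) + (osc_const * \<rho> ^ s) powr \<tau>))"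
        using osc_const \<rho> k by (intro besov_term_le_good[OF \<tau> good, of "[:coarse m (window_left m j):]"]) auto
      moreover have "\<exists>l. window_left m j \<le> x (m - int s) l \<and> x (m - int s) l \<le> window_right m j"
        using l False by (intro exI[of _ "l + 1"]) auto
      ultimately show ?thesis using bad by blast
    qed
  qed
qed

end

section \<open>Summation over all intervals\<close>

context nterm_spline
begin

text \<open>Capped at 1 so that \<open>powr_sum_le\<close> applies; for weights at most 1 a smaller
  exponent only enlarges the bound.\<close>

definition weight_exp :: "real \<Rightarrow> real" where "weight_exp \<tau> = min 1 (\<tau> / (2 * q))"

text \<open>The summands serve bad cells, the fine part on good cells, and the oscillation of the
  coarse part, in this order.\<close>

definition term_const :: "real \<Rightarrow> real" where
  "term_const \<tau> = trivial_const \<tau> * threshold powr (- weight_exp \<tau>) + good_const \<tau> + good_const \<tau> * osc_const powr \<tau>"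

lemma weight_exp: "\<tau> > 0 \<Longrightarrow> 0 < weight_exp \<tau>" "weight_exp \<tau> \<le> 1" "weight_exp \<tau> \<le> \<tau> / (2 * q)"
  using q by (auto simp: weight_exp_def)

lemma \<rho>_powr_less_1: "c > 0 \<Longrightarrow> \<rho> powr c < 1"
  using powr_less_mono2[of c \<rho> 1] \<rho> by simp

lemma consts_nonneg: "trivial_const \<tau> \<ge> 0" "good_const \<tau> \<ge> 0" "term_const \<tau> \<ge> 0"
  by (auto simp: trivial_const_def good_const_def term_const_def)

text \<open>Bad cells are absorbed into the first alternative: their weight divided by
  \<open>threshold\<close> is at least 1, so its power may multiply the trivial bound.\<close>

lemma besov_term_bound:
  assumes \<tau>: "\<tau> > 0"
  shows "besov_term \<tau> m j \<le> ennreal (term_const \<tau> * B powr \<tau> * fine_weight m j powr weight_exp \<tau>) \<or>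
    (\<exists>s. threshold \<le> fine_weight (m - int s) (anc s m j) \<and>
      (\<exists>l. window_left m j \<le> x (m - int s) l \<and> x (m - int s) l \<le> window_right m j) \<and>
      besov_term \<tau> m j \<le> ennreal (term_const \<tau> * B powr \<tau> * (fine_weight m j powr weight_exp \<tau> + (\<rho> powr \<tau>) ^ s)))"
proof (cases "threshold \<le> fine_weight m j")
  case True
  have "1 \<le> fine_weight m j / threshold" using True threshold by simp
  then have "1 \<le> (fine_weight m j / threshold) powr weight_exp \<tau>"
    using weight_exp[of \<tau>] \<tau> by (intro ge_one_powr_ge_zero) auto
  also have "\<dots> = threshold powr (- weight_exp \<tau>) * fine_weight m j powr weight_exp \<tau>"
    using threshold fine_weight_nonneg[of m j] by (simp add: powr_divide powr_minus field_simps)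
  finally have 1: "1 \<le> threshold powr (- weight_exp \<tau>) * fine_weight m j powr weight_exp \<tau>" .
  have "trivial_const \<tau> * B powr \<tau> * 1 \<le> trivial_const \<tau> * B powr \<tau> * (threshold powr (- weight_exp \<tau>) * fine_weight m j powr weight_exp \<tau>)"
    using consts_nonneg[of \<tau>] by (intro mult_left_mono 1) auto
  also have "\<dots> = (trivial_const \<tau> * threshold powr (- weight_exp \<tau>)) * (B powr \<tau> * fine_weight m j powr weight_exp \<tau>)" by simp
  also have "\<dots> \<le> term_const \<tau> * (B powr \<tau> * fine_weight m j powr weight_exp \<tau>)"
    using consts_nonneg[of \<tau>] by (intro mult_right_mono) (auto simp: term_const_def)
  finally have "ennreal (trivial_const \<tau> * B powr \<tau>) \<le> ennreal (term_const \<tau> * B powr \<tau> * fine_weight m j powr weight_exp \<tau>)"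
    by (intro ennreal_leI) (simp add: mult.assoc)
  then show ?thesis using besov_term_le_trivial[OF \<tau>, of m j] by (blast intro: order_trans)
next
  case False
  then have good: "fine_weight m j < threshold" by simp
  have fine_weight: "fine_weight m j powr (\<tau> / (2 * q)) \<le> fine_weight m j powr weight_exp \<tau>"
    using good threshold weight_exp(3)[of \<tau>] fine_weight_nonneg[of m j] by (intro powr_mono') auto
  have CB1: "good_const \<tau> \<le> term_const \<tau>" "good_const \<tau> * osc_const powr \<tau> \<le> term_const \<tau>"
    using consts_nonneg[of \<tau>] by (auto simp: term_const_def)
  have *: "good_const \<tau> * B powr \<tau> * fine_weight m j powr (\<tau> / (2 * q)) \<le> term_const \<tau> * B powr \<tau> * fine_weight m j powr weight_exp \<tau>"
    using CB1 fine_weight consts_nonneg[of \<tau>] by (intro mult_mono) auto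
  have "good_const \<tau> * B powr \<tau> * (fine_weight m j powr (\<tau> / (2 * q)) + (osc_const * \<rho> ^ s) powr \<tau>) \<le>
      term_const \<tau> * B powr \<tau> * (fine_weight m j powr weight_exp \<tau> + (\<rho> powr \<tau>) ^ s)" for s
  proof -
    have "(osc_const * \<rho> ^ s) powr \<tau> = osc_const powr \<tau> * (\<rho> powr \<tau>) ^ s"
      using \<rho> by (simp add: powr_mult powr_realpow[symmetric] powr_powr mult.commute)
    then have "good_const \<tau> * B powr \<tau> * (osc_const * \<rho> ^ s) powr \<tau> = (good_const \<tau> * osc_const powr \<tau>) * (B powr \<tau> * (\<rho> powr \<tau>) ^ s)"
      by simp
    also have "\<dots> \<le> term_const \<tau> * (B powr \<tau> * (\<rho> powr \<tau>) ^ s)"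
      using CB1 by (intro mult_right_mono) auto
    finally show ?thesis using * by (simp add: distrib_left mult.assoc)
  qed
  then have **: "ennreal (good_const \<tau> * B powr \<tau> * (fine_weight m j powr (\<tau> / (2 * q)) + (osc_const * \<rho> ^ s) powr \<tau>)) \<le>
      ennreal (term_const \<tau> * B powr \<tau> * (fine_weight m j powr weight_exp \<tau> + (\<rho> powr \<tau>) ^ s))" for s
    by (intro ennreal_leI)
  show ?thesis
    using besov_term_cases[OF \<tau> good] order_trans[OF _ ennreal_leI[OF *]] order_trans[OF _ **] by blast
qed

text \<open>After exchanging the sums, each B-spline meets at most \<open>3 * k + 1\<close> windows
  on every level not finer than its own, and these contribute a geometric series in the level
  difference.\<close>

lemma sum_fine_weight_powr_le:
  assumes J: "finite J" and \<tau>: "\<tau> > 0"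
  shows "(\<Sum>z\<in>J. fine_weight (fst z) (snd z) powr weight_exp \<tau>) \<le>
    real (card \<Lambda>) * (real (3 * k + 1) / (1 - \<rho> powr weight_exp \<tau>))"
proof -
  define r where "r = \<rho> powr weight_exp \<tau>"
  have r: "0 \<le> r" "r < 1" using \<rho> weight_exp(1)[OF \<tau>] \<rho>_powr_less_1 by (auto simp: r_def)
  let ?R = "\<lambda>z Q. fst z \<le> fst Q \<and> meets k (fst z) (snd z) Q"
  have "fine_weight m j powr weight_exp \<tau> \<le> (\<Sum>Q | Q \<in> \<Lambda> \<and> ?R (m, j) Q. r ^ nat (fst Q - m))" for m j
  proof -
    have "fine_weight m j powr weight_exp \<tau> \<le> (\<Sum>Q\<in>finer m j. (\<rho> ^ nat (fst Q - m)) powr weight_exp \<tau>)"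
      unfolding fine_weight_def using weight_exp[of \<tau>] \<tau> \<rho> by (intro powr_sum_le finite_finer) auto
    also have "\<dots> = (\<Sum>Q\<in>finer m j. r ^ nat (fst Q - m))"
      using \<rho> by (intro sum.cong) (auto simp: r_def powr_realpow[symmetric] powr_powr mult.commute)
    finally show ?thesis by (simp add: finer_def)
  qed
  then have "(\<Sum>z\<in>J. fine_weight (fst z) (snd z) powr weight_exp \<tau>) \<le>
      (\<Sum>z\<in>J. \<Sum>Q | Q \<in> \<Lambda> \<and> ?R z Q. r ^ nat (fst Q - fst z))"
    by (intro sum_mono) auto
  also have "\<dots> = (\<Sum>Q\<in>\<Lambda>. \<Sum>z | z \<in> J \<and> ?R z Q. r ^ nat (fst Q - fst z))"
    by (rule sum.swap_restrict[OF J fin])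
  also have "\<dots> \<le> (\<Sum>Q\<in>\<Lambda>. real (3 * k + 1) / (1 - r))"
  proof (rule sum_mono)
    fix Q :: "int \<times> int"
    \<comment> \<open>One geometric series is enough here: the second exponent is always 0, with
      ratio 0 and \<open>0 ^ 0 = 1\<close>.\<close>
    let ?key = "\<lambda>z. (nat (fst Q - fst z), 0 :: nat)"
    have "(\<Sum>z | z \<in> J \<and> ?R z Q. r ^ fst (?key z) * 0 ^ snd (?key z)) \<le> real (3 * k + 1) / ((1 - r) * (1 - 0))"
    proof (rule sum_geometric_fibers_le)
      fix t u :: nat
      let ?m = "fst Q - int t"
      have "{z \<in> {z \<in> J. ?R z Q}. ?key z = (t, u)} \<subseteq> Pair ?m ` {j. meets k ?m j Q}"
        by force
      then have "card {z \<in> {z \<in> J. ?R z Q}. ?key z = (t, u)} \<le> card (Pair ?m ` {j. meets k ?m j Q})"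
        by (intro card_mono finite_imageI card_meets) auto
      also have "\<dots> \<le> card {j. meets k ?m j Q}" by (intro card_image_le card_meets) auto
      also have "\<dots> \<le> 3 * k + 1" by (intro card_meets) auto
      finally show "card {z \<in> {z \<in> J. ?R z Q}. ?key z = (t, u)} \<le> 3 * k + 1" .
    qed (use J r in auto)
    then show "(\<Sum>z | z \<in> J \<and> ?R z Q. r ^ nat (fst Q - fst z)) \<le> real (3 * k + 1) / (1 - r)"
      by simp
  qed
  finally show ?thesis by (simp add: r_def)
qed

text \<open>
  \<open>s z\<close> selects a bad ancestor of \<open>z\<close>; near a fixed node of the ancestor's level there are only
  boundedly many windows of each finer level.
\<close>

lemma sum_bad_ancestors_le:
  assumes J: "finite J" and r: "0 \<le> r" "r < 1"
    and bad: "\<And>z. z \<in> J \<Longrightarrow> threshold \<le> fine_weight (fst z - int (s z)) (anc (s z) (fst z) (snd z))"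
    and node: "\<And>z. z \<in> J \<Longrightarrow> \<exists>l. window_left (fst z) (snd z) \<le> x (fst z - int (s z)) l \<and>
      x (fst z - int (s z)) l \<le> window_right (fst z) (snd z)"
  shows "(\<Sum>z\<in>J. r ^ s z) \<le>
    real (card \<Lambda>) * (real ((3 * k + 1) * (2 * k) * (2 * k)) / ((1 - \<rho>) * (1 - r)) / threshold)"
proof -
  define p where "p z = fst z - int (s z)" for z
  define a where "a z = anc (s z) (fst z) (snd z)" for z
  let ?R = "\<lambda>z Q. p z \<le> fst Q \<and> meets k (p z) (a z) Q"
  have "r ^ s z \<le> (\<Sum>Q | Q \<in> \<Lambda> \<and> ?R z Q. \<rho> ^ nat (fst Q - p z) * r ^ s z) / threshold" if z: "z \<in> J" for z
  proof -
    \<comment> \<open>Badness of the ancestor pays for the term: it is distributed over the fine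
      B-splines that make up the ancestor's weight.\<close>
    have "threshold * r ^ s z \<le> fine_weight (p z) (a z) * r ^ s z"
      using bad[OF z] r by (intro mult_right_mono) (auto simp: p_def a_def)
    also have "\<dots> = (\<Sum>Q | Q \<in> \<Lambda> \<and> ?R z Q. \<rho> ^ nat (fst Q - p z) * r ^ s z)"
      by (simp add: fine_weight_def finer_def sum_distrib_right)
    finally show ?thesis using threshold by (simp add: field_simps)
  qed
  then have "(\<Sum>z\<in>J. r ^ s z) \<le> (\<Sum>z\<in>J. (\<Sum>Q | Q \<in> \<Lambda> \<and> ?R z Q. \<rho> ^ nat (fst Q - p z) * r ^ s z) / threshold)"
    by (rule sum_mono)
  also have "\<dots> = (\<Sum>z\<in>J. \<Sum>Q | Q \<in> \<Lambda> \<and> ?R z Q. \<rho> ^ nat (fst Q - p z) * r ^ s z) / threshold"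
    by (simp add: sum_divide_distrib)
  also have "(\<Sum>z\<in>J. \<Sum>Q | Q \<in> \<Lambda> \<and> ?R z Q. \<rho> ^ nat (fst Q - p z) * r ^ s z) =
      (\<Sum>Q\<in>\<Lambda>. \<Sum>z | z \<in> J \<and> ?R z Q. \<rho> ^ nat (fst Q - p z) * r ^ s z)"
    by (rule sum.swap_restrict[OF J fin])
  also have "\<dots> \<le> (\<Sum>Q\<in>\<Lambda>. real ((3 * k + 1) * (2 * k) * (2 * k)) / ((1 - \<rho>) * (1 - r)))"
  proof (rule sum_mono)
    fix Q :: "int \<times> int"
    \<comment> \<open>The exponents are the numbers of levels from the ancestor down to
      \<open>Q\<close> and from the ancestor down to \<open>z\<close>.\<close>
    let ?key = "\<lambda>z. (nat (fst Q - p z), s z)"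
    have "(\<Sum>z | z \<in> J \<and> ?R z Q. \<rho> ^ fst (?key z) * r ^ snd (?key z)) \<le>
        real ((3 * k + 1) * (2 * k) * (2 * k)) / ((1 - \<rho>) * (1 - r))"
    proof (rule sum_geometric_fibers_le)
      fix t u :: nat
      let ?p = "fst Q - int t"
      let ?m = "?p + int u"
      let ?A = "\<lambda>l. {j. x ?m (j + 1 - int k) \<le> x ?p l \<and> x ?p l \<le> x ?m (j + int k)}"
      let ?I = "{i. meets k ?p i Q}"
      let ?U = "\<Union>i\<in>?I. \<Union>l\<in>{i + 1 - int k..i + int k}. ?A l"
      have fI: "finite ?I" "card ?I \<le> 3 * k + 1" using card_meets[of ?p Q k] by auto
      have fA: "finite (?A l)" "card (?A l) \<le> 2 * k" for l
        by (intro card_windows_at_node; simp)+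
      have fU: "finite ?U" by (intro finite_UN_I fI fA) auto
      \<comment> \<open>At most \<open>3 * k + 1\<close> ancestors meet \<open>Q\<close>, each
        ancestor's window has \<open>2 * k\<close> nodes, and each node lies in at most
        \<open>2 * k\<close> windows of the level of \<open>z\<close>.\<close>
      have "card ?U \<le> (\<Sum>i\<in>?I. card (\<Union>l\<in>{i + 1 - int k..i + int k}. ?A l))"
        by (rule card_UN_le[OF fI(1)])
      also have "\<dots> \<le> (\<Sum>i\<in>?I. \<Sum>l\<in>{i + 1 - int k..i + int k}. card (?A l))"
        by (intro sum_mono card_UN_le) auto
      also have "\<dots> \<le> (\<Sum>i\<in>?I. \<Sum>l\<in>{i + 1 - int k..i + int k}. 2 * k)"
        by (intro sum_mono fA)
      also have "\<dots> = card ?I * (2 * k) * (2 * k)" by (simp add: nat_mult_distrib)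
      also have "\<dots> \<le> (3 * k + 1) * (2 * k) * (2 * k)" by (intro mult_right_mono fI) auto
      finally have cU: "card ?U \<le> (3 * k + 1) * (2 * k) * (2 * k)" .
      have "{z \<in> {z \<in> J. ?R z Q}. ?key z = (t, u)} \<subseteq> Pair ?m ` ?U"
      proof
        fix z assume "z \<in> {z \<in> {z \<in> J. ?R z Q}. ?key z = (t, u)}"
        then have z: "z \<in> J" "p z = ?p" "meets k ?p (a z) Q" "s z = u" by auto
        have m: "fst z = ?m" using z(2,4) by (simp add: p_def)
        obtain l where l: "window_left (fst z) (snd z) \<le> x (p z) l" "x (p z) l \<le> window_right (fst z) (snd z)"
          using node[OF z(1)] unfolding p_def by blast
        have "x (p z) (a z + 1 - int k) \<le> window_left (fst z) (snd z)" "window_right (fst z) (snd z) \<le> x (p z) (a z + int k)"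
          using anc_window[OF k1(1), of 0 "s z" "fst z" "snd z"] by (simp_all add: p_def a_def window_left_def window_right_def)
        with l have "x (p z) (a z + 1 - int k) \<le> x (p z) l" "x (p z) l \<le> x (p z) (a z + int k)"
          by linarith+
        then have "l \<in> {a z + 1 - int k..a z + int k}" by simp
        moreover have "snd z \<in> ?A l" using l unfolding window_left_def window_right_def m z(2) by simp
        ultimately have "snd z \<in> ?U" using z(3) by blast
        then have "Pair ?m (snd z) \<in> Pair ?m ` ?U" by (rule imageI)
        then show "z \<in> Pair ?m ` ?U" unfolding m[symmetric] by simp
      qed
      then have "card {z \<in> {z \<in> J. ?R z Q}. ?key z = (t, u)} \<le> card (Pair ?m ` ?U)"
        by (intro card_mono finite_imageI fU)
      also have "\<dots> \<le> card ?U" by (rule card_image_le[OF fU])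
      also note cU
      finally show "card {z \<in> {z \<in> J. ?R z Q}. ?key z = (t, u)} \<le> (3 * k + 1) * (2 * k) * (2 * k)" .
    qed (use J r \<rho> in auto)
    then show "(\<Sum>z | z \<in> J \<and> ?R z Q. \<rho> ^ nat (fst Q - p z) * r ^ s z) \<le>
        real ((3 * k + 1) * (2 * k) * (2 * k)) / ((1 - \<rho>) * (1 - r))"
      by simp
  qed
  finally show ?thesis using threshold by (simp add: divide_right_mono)
qed

definition bernstein_const :: "real \<Rightarrow> real" where
  "bernstein_const \<tau> = term_const \<tau> * (real (3 * k + 1) / (1 - \<rho> powr weight_exp \<tau>) +
     real ((3 * k + 1) * (2 * k) * (2 * k)) / ((1 - \<rho>) * (1 - \<rho> powr \<tau>)) / threshold)"

lemma bernstein_const: "\<tau> > 0 \<Longrightarrow> bernstein_const \<tau> \<ge> 0"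
  using \<rho> \<rho>_powr_less_1[of \<tau>] \<rho>_powr_less_1[of "weight_exp \<tau>"] weight_exp[of \<tau>] threshold consts_nonneg[of \<tau>]
  unfolding bernstein_const_def by (intro mult_nonneg_nonneg add_nonneg_nonneg divide_nonneg_nonneg) auto

lemma sum_besov_terms_le:
  assumes J: "finite J" and \<tau>: "\<tau> > 0"
  shows "(\<Sum>z\<in>J. besov_term \<tau> (fst z) (snd z)) \<le> ennreal (bernstein_const \<tau> * B powr \<tau> * real (card \<Lambda>))"
proof -
  let ?d = "\<lambda>z. fine_weight (fst z) (snd z) powr weight_exp \<tau>"
  define r where "r = \<rho> powr \<tau>"
  have r: "0 \<le> r" "r < 1" using \<rho> \<tau> \<rho>_powr_less_1 by (auto simp: r_def)
  define c where "c = term_const \<tau> * B powr \<tau>"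
  have c: "c \<ge> 0" using consts_nonneg[of \<tau>] by (simp add: c_def)
  define P where "P z s \<longleftrightarrow> threshold \<le> fine_weight (fst z - int s) (anc s (fst z) (snd z)) \<and>
      (\<exists>l. window_left (fst z) (snd z) \<le> x (fst z - int s) l \<and> x (fst z - int s) l \<le> window_right (fst z) (snd z)) \<and>
      besov_term \<tau> (fst z) (snd z) \<le> ennreal (c * (?d z + r ^ s))" for z s
  \<comment> \<open>Cells for which the second alternative of \<open>besov_term_bound\<close> holds;
    all others satisfy the first.\<close>
  define J' where "J' = {z \<in> J. \<exists>s. P z s}"
  have J': "finite J'" "J' \<subseteq> J" using J by (auto simp: J'_def)
  define s where "s z = (SOME s. P z s)" for z
  have s: "P z (s z)" if "z \<in> J'" for z
    using that unfolding J'_def s_def by (auto intro: someI_ex)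
  have bound: "besov_term \<tau> (fst z) (snd z) \<le> ennreal (c * (?d z + (if z \<in> J' then r ^ s z else 0)))"
    if z: "z \<in> J" for z
  proof (cases "z \<in> J'")
    case True
    then show ?thesis using s[of z] by (simp add: P_def)
  next
    case False
    then have "\<not> P z s" for s using z by (auto simp: J'_def)
    then show ?thesis
      using besov_term_bound[OF \<tau>, of "fst z" "snd z"] False unfolding P_def c_def r_def by auto
  qed
  have "(\<Sum>z\<in>J. besov_term \<tau> (fst z) (snd z)) \<le>
      (\<Sum>z\<in>J. ennreal (c * (?d z + (if z \<in> J' then r ^ s z else 0))))"
    by (rule sum_mono[OF bound])
  also have "\<dots> = ennreal (\<Sum>z\<in>J. c * (?d z + (if z \<in> J' then r ^ s z else 0)))"
    using c r by (intro sum_ennreal) auto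
  also have "(\<Sum>z\<in>J. c * (?d z + (if z \<in> J' then r ^ s z else 0))) =
      c * ((\<Sum>z\<in>J. ?d z) + (\<Sum>z\<in>J'. r ^ s z))"
    using J J' by (simp add: sum_distrib_left[symmetric] sum.distrib sum.inter_restrict[symmetric] Int_absorb1)
  also have "\<dots> \<le> c * (real (card \<Lambda>) * (real (3 * k + 1) / (1 - \<rho> powr weight_exp \<tau>)) +
      real (card \<Lambda>) * (real ((3 * k + 1) * (2 * k) * (2 * k)) / ((1 - \<rho>) * (1 - r)) / threshold))"
    using s by (intro mult_left_mono add_mono sum_fine_weight_powr_le sum_bad_ancestors_le J J' \<tau> r c) (auto simp: P_def)
  also have "\<dots> = bernstein_const \<tau> * B powr \<tau> * real (card \<Lambda>)"
    by (simp add: bernstein_const_def c_def r_def algebra_simps)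
  finally show ?thesis by (simp add: ennreal_leI)
qed

lemma besov_quasinorm_le:
  assumes \<tau>: "\<tau> > 0"
  shows "besov_quasinorm k q \<tau> x g \<le> ennreal ((bernstein_const \<tau> * real (card \<Lambda>)) powr (1 / \<tau>) * B)"
proof -
  let ?f = "\<lambda>(m, j). besov_term \<tau> m j"
  \<comment> \<open>A sum of nonnegative extended reals is the supremum of its finite partial sums,
    so the finite estimate suffices.\<close>
  have "infsum ?f UNIV = (SUP F\<in>{F. finite F \<and> F \<subseteq> UNIV}. sum ?f F)"
    by (rule nonneg_infsum_complete) simp
  also have "\<dots> \<le> ennreal (bernstein_const \<tau> * B powr \<tau> * real (card \<Lambda>))"
    using sum_besov_terms_le[OF _ \<tau>] by (intro SUP_least) (auto simp: case_prod_unfold)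
  finally have "besov_quasinorm k q \<tau> x g \<le> ennreal_powr (ennreal (bernstein_const \<tau> * B powr \<tau> * real (card \<Lambda>))) (1 / \<tau>)"
    unfolding besov_quasinorm_def besov_term_def using \<tau> by (intro ennreal_powr_mono) auto
  also have "\<dots> = ennreal ((bernstein_const \<tau> * B powr \<tau> * real (card \<Lambda>)) powr (1 / \<tau>))"
    using bernstein_const[OF \<tau>] by simp
  also have "(bernstein_const \<tau> * B powr \<tau> * real (card \<Lambda>)) powr (1 / \<tau>) =
      (bernstein_const \<tau> * real (card \<Lambda>)) powr (1 / \<tau>) * (B powr \<tau>) powr (1 / \<tau>)"
    by (simp add: powr_mult)
  also have "(B powr \<tau>) powr (1 / \<tau>) = B" using B \<tau> by (simp add: powr_powr)
  finally show ?thesis .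
qed

end

thm nterm_spline.besov_quasinorm_le nterm_spline.bernstein_const

theorem theorem4p2:
  fixes \<alpha> \<tau> lam q :: real and k M0 :: nat
  assumes "\<alpha> > 0" and "\<tau> = 1 / \<alpha>" and "k \<ge> 2" and "M0 \<ge> 2" and "lam \<ge> 1" and "q \<ge> 1"
  shows "\<exists>c :: real. c > 0 \<and>
    (\<forall>x :: int \<Rightarrow> int \<Rightarrow> real. regular_multilevel_partition M0 lam x \<longrightarrow>
      (\<forall>n :: nat. n \<ge> 1 \<longrightarrow>
        (\<forall>g \<in> nterm_splines k x n.
           besov_quasinorm k q \<tau> x g \<le> ennreal (c * real n powr \<alpha>) * bmo_norm g)))"
proof -
  \<comment> \<open>Outside its locale \<open>bernstein_const\<close> takes only \<open>lam\<close>,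
    \<open>k\<close>, \<open>q\<close> and \<open>\<tau>\<close> as arguments, so \<open>C\<close>
    is fixed before the partition and the spline. The absolute value and the 1 make it positive
    without an instance of the locale.\<close>
  define C where "C = \<bar>nterm_spline.bernstein_const lam k q \<tau>\<bar> + 1"
  have \<tau>: "\<tau> > 0" and \<alpha>: "1 / \<tau> = \<alpha>" using assms by simp_all
  have C: "C > 0" by (simp add: C_def)
  have "besov_quasinorm k q \<tau> x g \<le> ennreal (C powr \<alpha> * real n powr \<alpha>) * bmo_norm g"
    if x: "regular_multilevel_partition M0 lam x" and n: "n \<ge> 1" and g: "g \<in> nterm_splines k x n"
    for x n g
  proof -
    obtain \<Lambda> a where \<Lambda>: "finite \<Lambda>" "card \<Lambda> \<le> n" and g_eq: "g = spline x (k - 1) \<Lambda> a"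
      using g unfolding nterm_splines_def spline_def[abs_def] by blast
    define K where "K = C powr \<alpha> * real n powr \<alpha>"
    have K: "K > 0" using C n by (simp add: K_def)
    have bound: "besov_quasinorm k q \<tau> x g \<le> ennreal (K * B)" if B: "B > 0" "bmo_norm g \<le> ennreal B" for B
    proof -
      interpret nterm_spline x M0 lam k \<Lambda> a B q
        using x assms \<Lambda> B unfolding g_eq by unfold_locales auto
      have "besov_quasinorm k q \<tau> x g \<le> ennreal ((bernstein_const \<tau> * real (card \<Lambda>)) powr \<alpha> * B)"
        using besov_quasinorm_le[OF \<tau>] by (simp add: g_def g_eq \<alpha>)
      also have "(bernstein_const \<tau> * real (card \<Lambda>)) powr \<alpha> * B \<le> (C * real n) powr \<alpha> * B"
        using bernstein_const[OF \<tau>] \<Lambda> assms(1) B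
        by (intro mult_right_mono powr_mono2 mult_mono) (auto simp: C_def)
      also have "(C * real n) powr \<alpha> * B = K * B"
        by (simp add: K_def powr_mult)
      finally show ?thesis by (simp add: ennreal_leI)
    qed
    show ?thesis
    proof (cases "bmo_norm g")
      case top
      then show ?thesis using K by (simp add: K_def[symmetric] ennreal_mult_top)
    next
      case (real b)
      have "besov_quasinorm k q \<tau> x g \<le> ennreal (K * b)"
      \<comment> \<open>The norm \<open>b\<close> may be 0, while the locale demands a positive
        bound; \<open>b + e / K\<close> provides one at the cost of \<open>e\<close>.\<close>
      proof (rule ennreal_le_epsilon)
        fix e :: real assume e: "e > 0"
        have "besov_quasinorm k q \<tau> x g \<le> ennreal (K * (b + e / K))"
          using real e K by (intro bound) (auto intro!: ennreal_leI add_nonneg_pos)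
        also have "K * (b + e / K) = K * b + e" using K by (simp add: algebra_simps)
        also have "ennreal (K * b + e) = ennreal (K * b) + ennreal e"
          using K real e by (intro ennreal_plus) auto
        finally show "besov_quasinorm k q \<tau> x g \<le> ennreal (K * b) + ennreal e" .
      qed
      then show ?thesis using real K by (simp add: K_def[symmetric] ennreal_mult)
    qed
  qed
  then show ?thesis using C by (intro exI[of _ "C powr \<alpha>"]) auto
qed

end
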